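(* Let $\mathcal{A}(t)$, $t\in I$, satisfy the standing assumptions given in the context. Let $\psi:I\times\mathbb{R}\to\mathbb{R}$ satisfy $\psi(t,0)=0$ for every $t\in I$ and be such that, for every $t\in I$, $\psi(t,\cdot)$ is continuously differentiable at $0$, the function $t\mapsto\partial_\xi\psi(t,0)$ belongs to $C^{\alpha/2}_{\rm loc}(I)$, and $\sup_{t\in I}\partial_\xi\psi(t,0)=:-\omega_0<0$. Set $\mathcal{B}(t)\zeta:=\mathcal{A}(t)\zeta+\partial_\xi\psi(t,0)\zeta$. Fix $\omega\in[0,\omega_0)$ and $s\in I$. For any $f\in C_b(\mathbb{R}^d)$ and $g\in C_\omega([s,+\infty)\times\mathbb{R}^d)$, let $z$ be the unique mild solution of the problem $$D_tz(t,x)=(\mathcal{B}(t)z)(t,x)+g(t,x),\ t\in(s,+\infty),\ x\in\mathbb{R}^d,\qquad z(s,x)=f(x),\ x\in\mathbb{R}^d.$$ Then $z$ belongs to $C_\omega([s,+\infty)\times\mathbb{R}^d)$ and $$\|z\|_{C_\omega([s,+\infty)\times\mathbb{R}^d)}\le\|f\|_\infty+\frac{1}{\omega_0-\omega}\|g\|_{C_\omega([s,+\infty)\times\mathbb{R}^d)}.$$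
   Context: Let $d\ge1$ and let $I$ be either an open right half-line or $I=\mathbb{R}$. For $t\in I$ let $(\mathcal{A}(t)\zeta)(x)=\sum_{i,j=1}^d q_{ij}(t,x)D_{ij}\zeta(x)+\sum_{i=1}^d b_i(t,x)D_i\zeta(x)$, $x\in\mathbb{R}^d$, with real, possibly unbounded coefficients; $Q=[q_{ij}]$, $b=(b_1,\dots,b_d)$. Standing assumptions on $\mathcal{A}(t)$: (i) $q_{ij},b_i\in C^{\alpha/2,\alpha}_{\rm loc}(I\times\mathbb{R}^d)$ for some $\alpha\in(0,1)$ (parabolic Hölder continuity on compact sets: exponent $\alpha/2$ in $t$, $\alpha$ in $x$); (ii) $Q(t,x)$ is symmetric and $\langle Q(t,x)\xi,\xi\rangle\ge\eta(t,x)|\xi|^2$ for all $(t,x)\in I\times\mathbb{R}^d$, $\xi\in\mathbb{R}^d$, for some $\eta:I\times\mathbb{R}^d\to\mathbb{R}$ with $\inf\eta=\eta_0>0$; (iii) there exist a nonnegative $\varphi\in C^2(\mathbb{R}^d)$ and constants $a,c>0$ with $\lim_{|x|\to+\infty}\varphi(x)=+\infty$ and $(\mathcal{A}(t)\varphi)(x)\le a-c\,\varphi(x)$ for all $(t,x)\in I\times\mathbb{R}^d$. $C_b(\cdot)$ denotes bounded continuous real functions with sup norm $\|\cdot\|_\infty$. Evolution operator (known to be well defined under these assumptions): for $s\in I$ and $f\in C_b(\mathbb{R}^d)$, $(t,x)\mapsto(G(t,s)f)(x)$ is the unique function in $C_b([s,+\infty)\times\mathbb{R}^d)\cap C^{1,2}((s,+\infty)\times\mathbb{R}^d)$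 with $D_tu=\mathcal{A}(t)u$ in $(s,+\infty)\times\mathbb{R}^d$, $u(s,\cdot)=f$. The evolution operator associated to $\mathcal{B}(t)$ in $C_b(\mathbb{R}^d)$ is $G_{\mathcal{B}}(t,s)f=\exp\big(\int_s^t\partial_\xi\psi(\sigma,0)\,d\sigma\big)G(t,s)f$, $t\ge s\in I$. For $\omega\in\mathbb{R}$ and $s\in I$, $C_\omega([s,+\infty)\times\mathbb{R}^d)$ is the set of the continuous functions $v:[s,+\infty)\to C_b(\mathbb{R}^d)$ (written $v(t,x)=v(t)(x)$) such that $\|v\|_{C_\omega([s,+\infty)\times\mathbb{R}^d)}:=\sup_{t\in[s,+\infty)}e^{\omega(t-s)}\|v(t,\cdot)\|_\infty<+\infty$. The mild solution $z$ is the function $z(t,x)=(G_{\mathcal{B}}(t,s)f)(x)+\int_s^t(G_{\mathcal{B}}(t,r)g(r,\cdot))(x)\,dr$, $t\ge s$, $x\in\mathbb{R}^d$.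
   Formalization: Continuity of v:[s,∞)→C_b in the definition of C_ω is taken locally uniformly in x (joint continuity), for g and z; with sup-norm continuity the claim fails, e.g. A(t)ζ=ζ''−xζ', ψ(t,ξ)=−ξ, g=0, f=sin. *)

theory Defs
  imports "HOL-Analysis.Analysis"
begin

text \<open>On the library set \<^const>\<open>bcontfun\<close>, this is the norm of the Banach space \<open>'a \<Rightarrow>\<^sub>C real\<close>.\<close>

definition sup_norm :: "('a \<Rightarrow> real) \<Rightarrow> real" where
  "sup_norm h = (SUP x. \<bar>h x\<bar>)"

definition has_partial :: "'d::finite \<Rightarrow> (real^'d \<Rightarrow> real) \<Rightarrow> real^'d \<Rightarrow> bool" where
  "has_partial i h x \<longleftrightarrow> (\<lambda>\<tau>. h (x + \<tau> *\<^sub>R axis i 1)) field_differentiable at 0"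

definition partial :: "'d::finite \<Rightarrow> (real^'d \<Rightarrow> real) \<Rightarrow> real^'d \<Rightarrow> real" where
  "partial i h x = deriv (\<lambda>\<tau>. h (x + \<tau> *\<^sub>R axis i 1)) 0"

definition C2 :: "(real^'d::finite \<Rightarrow> real) \<Rightarrow> bool" where
  "C2 h \<longleftrightarrow> continuous_on UNIV h \<and>
    (\<forall>i. (\<forall>x. has_partial i h x) \<and> continuous_on UNIV (partial i h)) \<and>
    (\<forall>i j. (\<forall>x. has_partial i (partial j h) x) \<and> continuous_on UNIV (partial i (partial j h)))"

definition C12 :: "real set \<Rightarrow> (real \<Rightarrow> real^'d::finite \<Rightarrow> real) \<Rightarrow> bool" where
  "C12 J u \<longleftrightarrow> continuous_on (J \<times> UNIV) (\<lambda>(t, x). u t x) \<and>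
    (\<forall>t\<in>J. \<forall>x. (\<lambda>\<tau>. u \<tau> x) field_differentiable at t) \<and>
    continuous_on (J \<times> UNIV) (\<lambda>(t, x). deriv (\<lambda>\<tau>. u \<tau> x) t) \<and>
    (\<forall>i. (\<forall>t\<in>J. \<forall>x. has_partial i (u t) x) \<and>
         continuous_on (J \<times> UNIV) (\<lambda>(t, x). partial i (u t) x)) \<and>
    (\<forall>i j. (\<forall>t\<in>J. \<forall>x. has_partial i (partial j (u t)) x) \<and>
           continuous_on (J \<times> UNIV) (\<lambda>(t, x). partial i (partial j (u t)) x))"

definition holder_loc :: "real \<Rightarrow> real set \<Rightarrow> (real \<Rightarrow> real) \<Rightarrow> bool" where
  "holder_loc \<beta> J h \<longleftrightarrow> (\<forall>K. compact K \<and> K \<subseteq> J \<longrightarrow>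
    (\<exists>C. \<forall>t\<in>K. \<forall>r\<in>K. \<bar>h t - h r\<bar> \<le> C * \<bar>t - r\<bar> powr \<beta>))"

definition parabolic_holder_loc ::
    "real \<Rightarrow> real set \<Rightarrow> (real \<Rightarrow> real^'d::finite \<Rightarrow> real) \<Rightarrow> bool" where
  "parabolic_holder_loc \<alpha> J h \<longleftrightarrow> (\<forall>K. compact K \<and> K \<subseteq> J \<times> UNIV \<longrightarrow>
    (\<exists>C. \<forall>(t, x)\<in>K. \<forall>(r, y)\<in>K.
      \<bar>h t x - h r y\<bar> \<le> C * (\<bar>t - r\<bar> powr (\<alpha> / 2) + norm (x - y) powr \<alpha>)))"

definition cont_differentiable_at :: "(real \<Rightarrow> real) \<Rightarrow> real \<Rightarrow> bool" where
  "cont_differentiable_at h a \<longleftrightarrow>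
    (\<forall>\<^sub>F \<xi> in nhds a. h field_differentiable at \<xi>) \<and> isCont (deriv h) a"

definition elliptic_op :: "(real \<Rightarrow> real^'d \<Rightarrow> real^'d^'d) \<Rightarrow> (real \<Rightarrow> real^'d \<Rightarrow> real^'d) \<Rightarrow> real \<Rightarrow>
    (real^'d::finite \<Rightarrow> real) \<Rightarrow> real^'d \<Rightarrow> real" where
  "elliptic_op Q b t h x =
    (\<Sum>i\<in>UNIV. \<Sum>j\<in>UNIV. Q t x $ i $ j * partial i (partial j h) x) +
    (\<Sum>i\<in>UNIV. b t x $ i * partial i h x)"

definition standing_assumptions :: "real \<Rightarrow> real set \<Rightarrow> (real \<Rightarrow> real^'d \<Rightarrow> real^'d^'d) \<Rightarrow>
    (real \<Rightarrow> real^'d \<Rightarrow> real^'d::finite) \<Rightarrow> bool" where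
  "standing_assumptions \<alpha> J Q b \<longleftrightarrow>
    (0 < \<alpha> \<and> \<alpha> < 1 \<and>
     (\<forall>i j. parabolic_holder_loc \<alpha> J (\<lambda>t x. Q t x $ i $ j)) \<and>
     (\<forall>i. parabolic_holder_loc \<alpha> J (\<lambda>t x. b t x $ i))) \<and>
    (\<forall>t\<in>J. \<forall>x. transpose (Q t x) = Q t x) \<and>
    (\<exists>\<eta> :: real \<Rightarrow> real^'d \<Rightarrow> real.
      (\<forall>t\<in>J. \<forall>x \<xi>. (Q t x *v \<xi>) \<bullet> \<xi> \<ge> \<eta> t x * (norm \<xi>)\<^sup>2) \<and>
      bdd_below ((\<lambda>(t, x). \<eta> t x) ` (J \<times> UNIV)) \<and>
      (INF (t, x)\<in>J \<times> UNIV. \<eta> t x) > 0) \<and>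
    (\<exists>\<phi> a c. C2 \<phi> \<and> (\<forall>x. \<phi> x \<ge> 0) \<and> a > 0 \<and> c > 0 \<and>
      filterlim \<phi> at_top at_infinity \<and>
      (\<forall>t\<in>J. \<forall>x. elliptic_op Q b t \<phi> x \<le> a - c * \<phi> x))"

definition bounded_classical_solution :: "(real \<Rightarrow> real^'d \<Rightarrow> real^'d^'d) \<Rightarrow>
    (real \<Rightarrow> real^'d \<Rightarrow> real^'d::finite) \<Rightarrow> real \<Rightarrow> (real^'d \<Rightarrow> real) \<Rightarrow>
    (real \<Rightarrow> real^'d \<Rightarrow> real) \<Rightarrow> bool" where
  "bounded_classical_solution Q b s f u \<longleftrightarrow>
    continuous_on ({s..} \<times> UNIV) (\<lambda>(t, x). u t x) \<and>
    bounded ((\<lambda>(t, x). u t x) ` ({s..} \<times> UNIV)) \<and>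
    C12 {s<..} u \<and>
    (\<forall>t>s. \<forall>x. deriv (\<lambda>\<tau>. u \<tau> x) t = elliptic_op Q b t (u t) x) \<and>
    (\<forall>x. u s x = f x)"

text \<open>\<open>G t s f\<close> is \<open>G(t,s)f\<close>. Only its values for \<open>s \<in> J\<close>, \<open>t \<ge> s\<close> and \<open>f \<in> C\<^sub>b(\<real>\<^sup>d)\<close>
  are constrained; there \<open>(t,x) \<mapsto> (G(t,s)f)(x)\<close> is the unique bounded classical solution
  of the Cauchy problem, so \<open>G\<close> is determined by \<open>J\<close>, \<open>Q\<close> and \<open>b\<close>.\<close>

definition evolution_operator :: "real set \<Rightarrow> (real \<Rightarrow> real^'d \<Rightarrow> real^'d^'d) \<Rightarrow>
    (real \<Rightarrow> real^'d \<Rightarrow> real^'d::finite) \<Rightarrow>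
    (real \<Rightarrow> real \<Rightarrow> (real^'d \<Rightarrow> real) \<Rightarrow> real^'d \<Rightarrow> real) \<Rightarrow> bool" where
  "evolution_operator J Q b G \<longleftrightarrow> (\<forall>s\<in>J. \<forall>f\<in>bcontfun.
    bounded_classical_solution Q b s f (\<lambda>t. G t s f) \<and>
    (\<forall>v. bounded_classical_solution Q b s f v \<longrightarrow> (\<forall>t\<ge>s. \<forall>x. v t x = G t s f x)))"

text \<open>The evolution operator of \<open>\<B>(t) = \<A>(t) + \<partial>\<^sub>\<xi>\<psi>(t,0)\<close>:\<close>

definition evolution_operator_B :: "(real \<Rightarrow> real \<Rightarrow> real) \<Rightarrow>
    (real \<Rightarrow> real \<Rightarrow> (real^'d \<Rightarrow> real) \<Rightarrow> real^'d \<Rightarrow> real) \<Rightarrow>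
    real \<Rightarrow> real \<Rightarrow> (real^'d::finite \<Rightarrow> real) \<Rightarrow> real^'d \<Rightarrow> real" where
  "evolution_operator_B \<psi> G t s f x =
    exp (integral {s..t} (\<lambda>\<sigma>. deriv (\<psi> \<sigma>) 0)) * G t s f x"

definition mild_solution :: "(real \<Rightarrow> real \<Rightarrow> real) \<Rightarrow>
    (real \<Rightarrow> real \<Rightarrow> (real^'d \<Rightarrow> real) \<Rightarrow> real^'d \<Rightarrow> real) \<Rightarrow> real \<Rightarrow>
    (real^'d::finite \<Rightarrow> real) \<Rightarrow> (real \<Rightarrow> real^'d \<Rightarrow> real) \<Rightarrow> real \<Rightarrow> real^'d \<Rightarrow> real" where
  "mild_solution \<psi> G s f g t x =
    evolution_operator_B \<psi> G t s f x +
    integral {s..t} (\<lambda>r. evolution_operator_B \<psi> G t r (g r) x)"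

text \<open>Continuity of \<open>v : [s,\<infinity>) \<rightarrow> C\<^sub>b(\<real>\<^sup>d)\<close> refers to locally uniform convergence in
  \<open>C\<^sub>b(\<real>\<^sup>d)\<close>, which amounts to continuity of \<open>v\<close> on \<open>[s,\<infinity>) \<times> \<real>\<^sup>d\<close> (lemma below), not to
  convergence in the sup norm: \<open>t \<mapsto> G(t,s)f\<close> is in general not continuous at \<open>t = s\<close> in the
  sup norm, for instance for \<open>\<A>(t)\<zeta> = \<zeta>'' - x \<zeta>'\<close> and \<open>f(x) = sin x\<close>, where
  \<open>(G(t,s)f)(x) = exp (- (1 - exp (- 2(t-s))) / 2) sin (exp (-(t-s)) x)\<close>.\<close>

definition C_omega_norm :: "real \<Rightarrow> real \<Rightarrow> (real \<Rightarrow> 'a::metric_space \<Rightarrow> real) \<Rightarrow> real" where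
  "C_omega_norm \<omega> s v = (SUP t\<in>{s..}. exp (\<omega> * (t - s)) * sup_norm (v t))"

definition C_omega :: "real \<Rightarrow> real \<Rightarrow> (real \<Rightarrow> 'a::metric_space \<Rightarrow> real) set" where
  "C_omega \<omega> s = {v. (\<forall>t\<ge>s. v t \<in> bcontfun) \<and>
    (\<forall>t\<ge>s. \<forall>K. compact K \<longrightarrow> uniform_limit K v (v t) (at t within {s..})) \<and>
    bdd_above ((\<lambda>t. exp (\<omega> * (t - s)) * sup_norm (v t)) ` {s..})}"

lemma locally_uniform_continuous_iff:
  fixes v :: "real \<Rightarrow> 'a::heine_borel \<Rightarrow> real"
  assumes "\<forall>t\<ge>s. continuous_on UNIV (v t)"
  shows "(\<forall>t\<ge>s. \<forall>K. compact K \<longrightarrow> uniform_limit K v (v t) (at t within {s..})) \<longleftrightarrow>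
    continuous_on ({s..} \<times> UNIV) (\<lambda>(t, x). v t x)" (is "?L \<longleftrightarrow> ?R")
proof
  assume L: ?L
  show ?R
    unfolding continuous_on_iff
  proof (intro ballI allI impI)
    fix q :: "real \<times> 'a" and e :: real
    assume "q \<in> {s..} \<times> UNIV" and e: "0 < e"
    then obtain t x where q: "q = (t, x)" and t: "t \<in> {s..}" by auto
    have "\<forall>\<^sub>F r in at t within {s..}. \<forall>y\<in>cball x 1. dist (v r y) (v t y) < e / 2"
      using L t e by (auto dest!: spec[where x = t] spec[where x = "cball x 1"] uniform_limitD[where e = "e / 2"])
    then obtain d where d: "d > 0"
      and *: "\<And>r y. r \<in> {s..} \<Longrightarrow> r \<noteq> t \<Longrightarrow> dist r t < d \<Longrightarrow> y \<in> cball x 1 \<Longrightarrow> dist (v r y) (v t y) < e / 2"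
      unfolding eventually_at by blast
    obtain d' where d': "d' > 0" "\<And>y. dist y x < d' \<Longrightarrow> dist (v t y) (v t x) < e / 2"
      using assms t e unfolding continuous_on_iff by (metis UNIV_I atLeast_iff half_gt_zero)
    show "\<exists>d>0. \<forall>p\<in>{s..} \<times> UNIV. dist p q < d \<longrightarrow>
        dist (case p of (t, x) \<Rightarrow> v t x) (case q of (t, x) \<Rightarrow> v t x) < e"
      unfolding q prod.case
    proof (intro exI[of _ "min d (min d' 1)"] conjI ballI impI)
      fix p :: "real \<times> 'a"
      assume p: "p \<in> {s..} \<times> UNIV" and dp: "dist p (t, x) < min d (min d' 1)"
      obtain r y where ry: "p = (r, y)" by (cases p)
      have 1: "dist r t < d" "dist y x < d'" "dist x y \<le> 1"
        using dist_fst_le[of p "(t, x)"] dist_snd_le[of p "(t, x)"] dp ry by (auto simp: dist_commute)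
      have "dist (v r y) (v t y) < e / 2"
        using *[of r y] p ry 1 e by (cases "r = t") auto
      then show "dist (case p of (t, x) \<Rightarrow> v t x) (v t x) < e"
        using d'(2)[OF 1(2)] dist_triangle[of "v r y" "v t x" "v t y"] by (simp add: ry)
    qed (use d d' in auto)
  qed
next
  assume R: ?R
  show ?L
  proof (intro allI impI uniform_limitI)
    fix t e :: real and K :: "'a set"
    assume t: "s \<le> t" and K: "compact K" and e: "0 < e"
    have "uniformly_continuous_on ({s..t + 1} \<times> K) (\<lambda>(t, x). v t x)"
      by (rule compact_uniformly_continuous[OF continuous_on_subset[OF R]])
        (auto intro: compact_Times K)
    then obtain d where d: "d > 0"
      and *: "\<And>r y. r \<in> {s..t + 1} \<Longrightarrow> y \<in> K \<Longrightarrow> dist r t < d \<Longrightarrow> dist (v r y) (v t y) < e"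
      unfolding uniformly_continuous_on_def using e t
      by (force simp: dist_Pair_Pair)
    show "\<forall>\<^sub>F r in at t within {s..}. \<forall>y\<in>K. dist (v r y) (v t y) < e"
      unfolding eventually_at using d *
      by (intro exI[of _ "min d 1"]) (auto simp: dist_real_def)
  qed
qed

end

theory Submission
  imports Defs
begin

text \<open>The contraction property of \<open>G(t,r)\<close> and \<open>\<partial>\<^sub>\<xi>\<psi>(\<cdot>,0) \<le> -\<omega>\<^sub>0\<close> give
  \<open>\<parallel>G\<^sub>\<B>(t,r)h\<parallel> \<le> exp(-\<omega>\<^sub>0(t-r)) \<parallel>h\<parallel>\<close>, from which the norm estimate follows by integration.
  What needs care is that \<open>r \<mapsto> (G\<^sub>\<B>(t,r)g(r))(x)\<close> is integrable and that the integral is continuous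
  in \<open>(t,x)\<close>. Two-sided continuity in \<open>r\<close> would need parabolic regularity theory; right
  continuity only needs the maximum principle with the Lyapunov function \<open>\<phi>\<close>, and it already implies
  measurability. Continuity of the integral then follows by dominated convergence, because each
  \<open>(t,x) \<mapsto> (G\<^sub>\<B>(t,r)g(r))(x)\<close> is continuous.\<close>

section \<open>Second-order conditions at a maximum\<close>

text \<open>\<open>C2\<close> and \<open>C12\<close> speak only of iterated partial derivatives;
  this bridges to the total derivative, so that functions can be restricted to arbitrary lines. The
  increment is split into one move per coordinate, and the mean value inequality controls each
  move.\<close>

lemma has_derivative_continuous_partials:
  fixes h :: "real^'d::finite \<Rightarrow> real"
  assumes diff: "\<And>i x. has_partial i h x"
    and cont: "\<And>i. continuous_on UNIV (partial i h)"
  shows "(h has_derivative (\<lambda>v. \<Sum>i\<in>UNIV. v $ i * partial i h x)) (at x)"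
proof -
  have line: "((\<lambda>\<tau>. h (y + \<tau> *\<^sub>R axis i 1)) has_real_derivative partial i h (y + \<tau> *\<^sub>R axis i 1)) (at \<tau>)"
    for y \<tau> and i :: 'd
  proof -
    have "((\<lambda>\<sigma>. h ((y + \<tau> *\<^sub>R axis i 1) + \<sigma> *\<^sub>R axis i 1)) has_real_derivative
        partial i h (y + \<tau> *\<^sub>R axis i 1)) (at 0)"
      using diff[of i "y + \<tau> *\<^sub>R axis i 1"]
      unfolding has_partial_def partial_def by (rule field_differentiable_derivI)
    then have "((\<lambda>\<sigma>. h ((y + \<tau> *\<^sub>R axis i 1) + (\<sigma> - \<tau>) *\<^sub>R axis i 1)) has_real_derivative
        partial i h (y + \<tau> *\<^sub>R axis i 1)) (at \<tau>)"
      using DERIV_shift[of "\<lambda>\<sigma>. h ((y + \<tau> *\<^sub>R axis i 1) + (\<sigma> - \<tau>) *\<^sub>R axis i 1)" _ 0 \<tau>] by simp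
    then show ?thesis by (simp add: algebra_simps)
  qed
  have bound: "\<exists>\<delta>>0. \<forall>v. norm v < \<delta> \<longrightarrow>
      \<bar>h (x + v) - h x - (\<Sum>i\<in>UNIV. v $ i * partial i h x)\<bar> \<le> e * norm v" if "e > 0" for e
  proof -
    \<comment> \<open>There are \<open>CARD('d)\<close> coordinate moves, each contributing an error
      of at most \<open>e' * norm v\<close>.\<close>
    define e' where "e' = e / real CARD('d)"
    have e': "e' > 0" using that by (simp add: e'_def)
    have "\<exists>\<delta>>0. \<forall>y. norm (y - x) < \<delta> \<longrightarrow> \<bar>partial i h y - partial i h x\<bar> < e'" for i
      using cont[of i] e' unfolding continuous_on_iff dist_norm by auto
    then obtain \<delta>i where \<delta>i: "\<And>i. \<delta>i i > 0"
      "\<And>i y. norm (y - x) < \<delta>i i \<Longrightarrow> \<bar>partial i h y - partial i h x\<bar> < e'" by metis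
    define \<delta> where "\<delta> = Min (range \<delta>i)"
    have \<delta>: "\<delta> > 0" using \<delta>i(1) by (simp add: \<delta>_def)
    have \<delta>': "\<bar>partial i h y - partial i h x\<bar> < e'" if "norm (y - x) < \<delta>" for i y
      using \<delta>i(2)[of y i] that by (simp add: \<delta>_def)
    \<comment> \<open>Induction on the set \<open>S\<close> of coordinates in which \<open>v\<close>
      may be nonzero.\<close>
    have "\<bar>h (x + v) - h x - (\<Sum>i\<in>S. v $ i * partial i h x)\<bar> \<le> real (card S) * (e' * norm v)"
      if "finite S" "norm v < \<delta>" "\<And>i. i \<notin> S \<Longrightarrow> v $ i = 0" for S :: "'d set" and v
      using that
    proof (induction S arbitrary: v rule: finite_induct)
      case empty
      then have "v = 0" by (simp add: vec_eq_iff)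
      then show ?case by simp
    next
      case (insert k S)
      \<comment> \<open>Deleting the \<open>k\<close>-th coordinate leaves an increment supported on
        \<open>S\<close>. The segment from \<open>x + v'\<close> to \<open>x + v\<close> stays
        within distance \<open>norm v\<close> of \<open>x\<close>, where the partial derivatives are
        under control.\<close>
      define v' where "v' = v - v $ k *\<^sub>R axis k 1"
      have v'_nth: "v' $ i = (if i = k then 0 else v $ i)" for i
        by (auto simp: v'_def axis_def)
      have v: "x + v' + v $ k *\<^sub>R axis k 1 = x + v" by (simp add: v'_def)
      have small: "norm (v' + \<tau> *\<^sub>R axis k 1) \<le> norm v" if "\<bar>\<tau>\<bar> \<le> \<bar>v $ k\<bar>" for \<tau>
        by (rule norm_le_componentwise_cart) (use that in \<open>auto simp: v'_nth axis_def\<close>)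
      have IH: "\<bar>h (x + v') - h x - (\<Sum>i\<in>S. v' $ i * partial i h x)\<bar> \<le> real (card S) * (e' * norm v)"
      proof -
        have n: "norm v' \<le> norm v" using small[of 0] by simp
        have "\<bar>h (x + v') - h x - (\<Sum>i\<in>S. v' $ i * partial i h x)\<bar> \<le> real (card S) * (e' * norm v')"
          by (rule insert.IH) (use n insert.prems in \<open>auto simp: v'_nth\<close>)
        also have "\<dots> \<le> real (card S) * (e' * norm v)"
          using n e' by (intro mult_left_mono) auto
        finally show ?thesis .
      qed
      have S: "(\<Sum>i\<in>S. v' $ i * partial i h x) = (\<Sum>i\<in>S. v $ i * partial i h x)"
        using insert.hyps by (intro sum.cong) (auto simp: v'_nth)
      \<comment> \<open>After subtracting the linear part, the derivative of \<open>l\<close> is the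
        difference of \<open>partial k h\<close> at a nearby point and at \<open>x\<close>, hence at
        most \<open>e'\<close> in absolute value.\<close>
      define l where "l = (\<lambda>\<tau>. h ((x + v') + \<tau> *\<^sub>R axis k 1) - \<tau> * partial k h x)"
      have "norm (l (v $ k) - l 0) \<le> e' * norm (v $ k - 0)"
      proof (rule field_differentiable_bound[where S = "closed_segment 0 (v $ k)"])
        fix \<tau> assume \<tau>: "\<tau> \<in> closed_segment 0 (v $ k)"
        show "(l has_field_derivative partial k h ((x + v') + \<tau> *\<^sub>R axis k 1) - partial k h x)
            (at \<tau> within closed_segment 0 (v $ k))"
          unfolding l_def
          by (auto intro!: derivative_eq_intros DERIV_subset[OF line])
        have "\<bar>\<tau>\<bar> \<le> \<bar>v $ k\<bar>"
          using \<tau> by (auto simp: closed_segment_eq_real_ivl split: if_splits)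
        from small[OF this] insert.prems
        have "norm (((x + v') + \<tau> *\<^sub>R axis k 1) - x) < \<delta>" by (simp add: algebra_simps)
        from \<delta>'[OF this, of k]
        show "norm (partial k h ((x + v') + \<tau> *\<^sub>R axis k 1) - partial k h x) \<le> e'" by simp
      qed auto
      then have "\<bar>h (x + v) - h (x + v') - v $ k * partial k h x\<bar> \<le> e' * \<bar>v $ k\<bar>"
        unfolding l_def v by (simp add: diff_diff_eq add.commute)
      also have "\<dots> \<le> e' * norm v"
        using e' component_le_norm_cart[of v k] by simp
      finally have "\<bar>h (x + v) - h (x + v') - v $ k * partial k h x\<bar> \<le> e' * norm v" .
      then show ?case
        using IH insert.hyps S by (simp add: algebra_simps)
    qed
    from this[of UNIV] \<delta> show ?thesis
      by (intro exI[of _ \<delta>]) (auto simp: e'_def)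
  qed
  have "bounded_linear (\<lambda>v::real^'d. \<Sum>i\<in>UNIV. v $ i * partial i h x)"
    by (intro bounded_linear_sum bounded_linear_mult_const bounded_linear_vec_nth)
  then show ?thesis
    unfolding has_derivative_at_alt
  proof (intro conjI allI impI)
    fix e :: real assume "0 < e"
    from bound[OF this] obtain \<delta> where \<delta>: "\<delta> > 0"
      "\<And>v. norm v < \<delta> \<Longrightarrow> \<bar>h (x + v) - h x - (\<Sum>i\<in>UNIV. v $ i * partial i h x)\<bar> \<le> e * norm v"
      by blast
    show "\<exists>d>0. \<forall>y. norm (y - x) < d \<longrightarrow>
        norm (h y - h x - (\<Sum>i\<in>UNIV. (y - x) $ i * partial i h x)) \<le> e * norm (y - x)"
      using \<delta>(1) \<delta>(2)[of "_ - x"] by (intro exI[of _ \<delta>]) auto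
  qed
qed

lemma has_real_derivative_along_line:
  fixes h :: "real^'d::finite \<Rightarrow> real"
  assumes "\<And>i x. has_partial i h x" "\<And>i. continuous_on UNIV (partial i h)"
  shows "((\<lambda>\<tau>. h (x + \<tau> *\<^sub>R \<xi>)) has_real_derivative
    (\<Sum>i\<in>UNIV. \<xi> $ i * partial i h (x + \<tau> *\<^sub>R \<xi>))) (at \<tau>)"
proof -
  have "((\<lambda>\<tau>. x + \<tau> *\<^sub>R \<xi>) has_derivative (\<lambda>\<sigma>. \<sigma> *\<^sub>R \<xi>)) (at \<tau>)"
    by (auto intro!: derivative_eq_intros)
  from has_derivative_compose[OF this has_derivative_continuous_partials[OF assms]]
  show ?thesis
    unfolding has_field_derivative_def
    by (rule has_derivative_eq_rhs) (auto simp: fun_eq_iff sum_distrib_left mult_ac)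
qed

text \<open>The maximum forces \<open>p' 0 = 0\<close>. If \<open>l\<close> were positive,
  \<open>p'\<close> would be positive just to the right of 0, and by the mean value theorem
  \<open>p\<close> would exceed \<open>p 0\<close> there.\<close>

lemma second_derivative_at_max_nonpos:
  fixes p p' :: "real \<Rightarrow> real"
  assumes p: "\<And>\<tau>. (p has_real_derivative p' \<tau>) (at \<tau>)"
    and p': "(p' has_real_derivative l) (at 0)"
    and max: "\<And>\<tau>. p \<tau> \<le> p 0"
  shows "l \<le> 0"
proof (rule ccontr)
  assume "\<not> l \<le> 0"
  then have "l > 0" by simp
  have 0: "p' 0 = 0"
    by (rule DERIV_local_max[OF p, of 1]) (use max in auto)
  obtain d where d: "d > 0" "\<And>\<sigma>. \<sigma> > 0 \<Longrightarrow> \<sigma> < d \<Longrightarrow> p' \<sigma> > 0"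
    using DERIV_pos_inc_right[OF p' \<open>l > 0\<close>] 0 by auto
  obtain \<sigma> where \<sigma>: "0 < \<sigma>" "\<sigma> < d / 2" "p (d / 2) - p 0 = (d / 2 - 0) * p' \<sigma>"
    using MVT2[of 0 "d / 2" p p'] p d(1) by auto
  moreover have "p' \<sigma> > 0" using \<sigma>(1,2) by (intro d(2)) auto
  ultimately have "(d / 2 - 0) * p' \<sigma> > 0" using d(1) by simp
  then show False using \<sigma>(3) max[of "d / 2"] by linarith
qed

text \<open>Along the line through \<open>x\<close> in direction \<xi> the function has a maximum at
  parameter 0, and its second derivative there is the Hessian form at \<xi>.\<close>

lemma C2_hessian_at_max_nonpos:
  fixes h :: "real^'d::finite \<Rightarrow> real"
  assumes h: "C2 h" and max: "\<And>y. h y \<le> h x"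
  shows "(\<Sum>i\<in>UNIV. \<Sum>j\<in>UNIV. \<xi> i * \<xi> j * partial i (partial j h) x) \<le> 0"
proof -
  define v :: "real^'d" where "v = (\<chi> i. \<xi> i)"
  have 1: "((\<lambda>\<tau>. h (x + \<tau> *\<^sub>R v)) has_real_derivative
      (\<Sum>j\<in>UNIV. v $ j * partial j h (x + \<tau> *\<^sub>R v))) (at \<tau>)" for \<tau>
    using h by (intro has_real_derivative_along_line) (auto simp: C2_def)
  have 2: "((\<lambda>\<tau>. partial j h (x + \<tau> *\<^sub>R v)) has_real_derivative
      (\<Sum>i\<in>UNIV. v $ i * partial i (partial j h) (x + \<tau> *\<^sub>R v))) (at \<tau>)" for \<tau> and j :: 'd
    using h by (intro has_real_derivative_along_line) (auto simp: C2_def)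
  have 3: "((\<lambda>\<tau>. \<Sum>j\<in>UNIV. v $ j * partial j h (x + \<tau> *\<^sub>R v)) has_real_derivative
      (\<Sum>j\<in>UNIV. v $ j * (\<Sum>i\<in>UNIV. v $ i * partial i (partial j h) (x + 0 *\<^sub>R v)))) (at 0)"
    by (intro DERIV_sum DERIV_cmult 2)
  have "(\<Sum>j\<in>UNIV. v $ j * (\<Sum>i\<in>UNIV. v $ i * partial i (partial j h) (x + 0 *\<^sub>R v))) \<le> 0"
    by (rule second_derivative_at_max_nonpos[OF 1 3]) (use max in simp)
  also have "(\<Sum>j\<in>UNIV. v $ j * (\<Sum>i\<in>UNIV. v $ i * partial i (partial j h) (x + 0 *\<^sub>R v))) =
      (\<Sum>j\<in>UNIV. \<Sum>i\<in>UNIV. \<xi> i * \<xi> j * partial i (partial j h) x)"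
    by (simp add: v_def sum_distrib_left mult_ac)
  finally show ?thesis by (subst sum.swap)
qed

lemma C2_partial_at_max_eq_0:
  fixes h :: "real^'d::finite \<Rightarrow> real"
  assumes h: "C2 h" and max: "\<And>y. h y \<le> h x"
  shows "partial i h x = 0"
proof (rule DERIV_local_max)
  show "((\<lambda>\<tau>. h (x + \<tau> *\<^sub>R axis i 1)) has_real_derivative partial i h x) (at 0)"
    using h unfolding C2_def has_partial_def partial_def by (blast intro: field_differentiable_derivI)
qed (use max in \<open>auto intro: zero_less_one\<close>)

text \<open>Splitting off the rank one matrix built from the \<open>k\<close>-th row leaves the Schur complement of
  \<open>q k k\<close>, which is positive definite on the remaining indices.\<close>

lemma sum_posdef_mult_nonpos:
  fixes q h :: "'d::finite \<Rightarrow> 'd \<Rightarrow> real"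
  assumes "finite S"
    and "\<And>i j. q i j = q j i"
    and "\<And>\<xi>. (\<exists>i\<in>S. \<xi> i \<noteq> 0) \<Longrightarrow> (\<Sum>i\<in>S. \<Sum>j\<in>S. q i j * \<xi> i * \<xi> j) > 0"
    and "\<And>\<xi>. (\<Sum>i\<in>S. \<Sum>j\<in>S. \<xi> i * \<xi> j * h i j) \<le> 0"
  shows "(\<Sum>i\<in>S. \<Sum>j\<in>S. q i j * h i j) \<le> 0"
  using assms
proof (induction S arbitrary: q rule: finite_induct)
  case empty
  then show ?case by simp
next
  case (insert k S)
  note fin = insert.hyps(1) and k = insert.hyps(2)
  note sym = insert.prems(1) and pos = insert.prems(2) and neg = insert.prems(3)
  \<comment> \<open>The double sum breaks into corner, row, column and remaining block.\<close>
  have split: "(\<Sum>i\<in>insert k S. \<Sum>j\<in>insert k S. F i j) =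
      F k k + (\<Sum>j\<in>S. F k j) + (\<Sum>j\<in>S. F j k) + (\<Sum>i\<in>S. \<Sum>j\<in>S. F i j)" for F :: "'d \<Rightarrow> 'd \<Rightarrow> real"
    using fin k by (simp add: sum.distrib algebra_simps)
  have qkk: "q k k > 0"
  proof -
    have S0: "(\<Sum>j\<in>S. F j * (if j = k then 1 else 0)) = 0" for F :: "'d \<Rightarrow> real"
      using k by (intro sum.neutral ballI) auto
    have "(\<Sum>i\<in>S. \<Sum>j\<in>S. q i j * (if i = k then 1 else 0) * (if j = k then 1 else 0)) = 0"
      using k by (intro sum.neutral ballI) auto
    moreover have "(\<Sum>j\<in>S. q j k * (if j = k then 1 else 0)) = 0" 
      "(\<Sum>j\<in>S. q k j * (if j = k then 1 else 0)) = 0"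
      using S0 by auto
    ultimately show ?thesis
      using pos[of "\<lambda>i. if i = k then 1 else 0"] unfolding split by simp
  qed
  have symS: "q i k = q k i" if "i \<in> S" for i by (rule sym)
  define q' where "q' = (\<lambda>i j. q i j - q k i * q k j / q k k)"
  have "(\<Sum>i\<in>S. \<Sum>j\<in>S. q' i j * h i j) \<le> 0"
  proof (rule insert.IH)
    show "q' i j = q' j i" for i j using sym by (simp add: q'_def mult_ac)
    show "(\<Sum>i\<in>S. \<Sum>j\<in>S. \<xi> i * \<xi> j * h i j) \<le> 0" for \<xi>
    proof -
      have "(\<Sum>j\<in>S. (if j = k then 0 else \<xi> j) * F j) = (\<Sum>j\<in>S. \<xi> j * F j)" for F
        using k by (intro sum.cong) auto
      then show ?thesis
        using neg[of "\<lambda>i. if i = k then 0 else \<xi> i"] unfolding split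
        using k by (simp add: mult.assoc flip: sum_distrib_left)
    qed
    show "(\<Sum>i\<in>S. \<Sum>j\<in>S. q' i j * \<xi> i * \<xi> j) > 0" if ex: "\<exists>i\<in>S. \<xi> i \<noteq> 0" for \<xi>
    proof -
      define m where "m = (\<Sum>j\<in>S. q k j * \<xi> j)"
      \<comment> \<open>The value at \<open>k\<close> minimises the quadratic form of
        \<open>q\<close> when the other entries are those of \<xi>. Completing the square shows that
        this minimum is the form of \<open>q'\<close> at \<xi>, which is therefore positive.\<close>
      define \<zeta> where "\<zeta> = (\<lambda>i. if i = k then - m / q k k else \<xi> i)"
      have \<zeta>S: "\<zeta> i = \<xi> i" if "i \<in> S" for i using that k by (auto simp: \<zeta>_def)
      have "0 < (\<Sum>i\<in>insert k S. \<Sum>j\<in>insert k S. q i j * \<zeta> i * \<zeta> j)"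
        using ex \<zeta>S by (intro pos) auto
      also have "\<dots> = q k k * \<zeta> k * \<zeta> k + \<zeta> k * m + \<zeta> k * m + (\<Sum>i\<in>S. \<Sum>j\<in>S. q i j * \<xi> i * \<xi> j)"
        unfolding split m_def sum_distrib_left
        using \<zeta>S symS by (simp add: mult_ac)
      also have "q k k * \<zeta> k * \<zeta> k + \<zeta> k * m + \<zeta> k * m = - (m * m / q k k)"
        using qkk by (simp add: \<zeta>_def field_simps)
      also have "m * m / q k k = (\<Sum>i\<in>S. \<Sum>j\<in>S. q k i * q k j / q k k * \<xi> i * \<xi> j)"
        unfolding m_def sum_product sum_divide_distrib by (simp add: mult_ac)
      finally show ?thesis by (simp add: q'_def sum_subtractf algebra_simps)
    qed
  qed
  \<comment> \<open>The rank one part is the form of \<open>h\<close> evaluated at the row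
    \<open>q k\<close>, divided by the positive number \<open>q k k\<close>.\<close>
  moreover have "(\<Sum>i\<in>insert k S. \<Sum>j\<in>insert k S. q k i * q k j * h i j) / q k k \<le> 0"
    using neg[of "q k"] qkk by (simp add: divide_le_0_iff)
  moreover have "(\<Sum>i\<in>insert k S. \<Sum>j\<in>insert k S. q i j * h i j) =
      (\<Sum>i\<in>insert k S. \<Sum>j\<in>insert k S. q k i * q k j * h i j) / q k k + (\<Sum>i\<in>S. \<Sum>j\<in>S. q' i j * h i j)"
  proof -
    have "(\<Sum>i\<in>insert k S. \<Sum>j\<in>insert k S. q i j * h i j) =
        (\<Sum>i\<in>insert k S. \<Sum>j\<in>insert k S. q k i * q k j / q k k * h i j) +
        (\<Sum>i\<in>insert k S. \<Sum>j\<in>insert k S. q' i j * h i j)"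
      by (simp add: q'_def algebra_simps flip: sum.distrib)
    also have "(\<Sum>i\<in>insert k S. \<Sum>j\<in>insert k S. q' i j * h i j) = (\<Sum>i\<in>S. \<Sum>j\<in>S. q' i j * h i j)"
      unfolding split using qkk symS by (simp add: q'_def)
    finally show ?thesis by (simp add: sum_divide_distrib)
  qed
  ultimately show ?case by linarith
qed

text \<open>At a maximum the drift term vanishes with the gradient, and the second-order term pairs
  a positive definite matrix with a negative semidefinite Hessian.\<close>

lemma elliptic_op_at_max_nonpos:
  fixes h :: "real^'d::finite \<Rightarrow> real"
  assumes h: "C2 h" and max: "\<And>y. h y \<le> h x"
    and sym: "transpose (Q t x) = Q t x"
    and pos: "\<And>\<xi>. \<xi> \<noteq> 0 \<Longrightarrow> (Q t x *v \<xi>) \<bullet> \<xi> > 0"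
  shows "elliptic_op Q b t h x \<le> 0"
proof -
  have "(\<Sum>i\<in>UNIV. \<Sum>j\<in>UNIV. Q t x $ i $ j * partial i (partial j h) x) \<le> 0"
  proof (rule sum_posdef_mult_nonpos)
    show "Q t x $ i $ j = Q t x $ j $ i" for i j
      using sym by (metis transpose_def vec_lambda_beta)
    show "(\<Sum>i\<in>UNIV. \<Sum>j\<in>UNIV. Q t x $ i $ j * \<xi> i * \<xi> j) > 0" if "\<exists>i\<in>UNIV. \<xi> i \<noteq> 0" for \<xi>
    proof -
      define v :: "real^'d" where "v = (\<chi> i. \<xi> i)"
      have "v \<noteq> 0" using that by (auto simp: v_def vec_eq_iff)
      from pos[OF this] show ?thesis
        by (simp add: v_def inner_vec_def matrix_vector_mult_def sum_distrib_right sum_distrib_left mult_ac)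
    qed
  qed (use C2_hessian_at_max_nonpos[OF h max] in auto)
  then show ?thesis
    by (simp add: elliptic_op_def C2_partial_at_max_eq_0[OF h max])
qed

section \<open>The maximum principle\<close>

lemma has_partial_diff:
  assumes "has_partial i h1 x" "has_partial i h2 x"
  shows "has_partial i (\<lambda>y. h1 y - h2 y) x"
    and "partial i (\<lambda>y. h1 y - h2 y) x = partial i h1 x - partial i h2 x"
  using assms unfolding has_partial_def partial_def
  by (auto intro: field_differentiable_diff)

lemma has_partial_cmult:
  assumes "has_partial i h x"
  shows "has_partial i (\<lambda>y. K * h y) x"
    and "partial i (\<lambda>y. K * h y) x = K * partial i h x"
  using assms unfolding has_partial_def partial_def
  by (auto intro: field_differentiable_mult)

lemma C2_diff:
  assumes "C2 h1" "C2 h2"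
  shows "C2 (\<lambda>y. h1 y - h2 y)"
    and "elliptic_op Q b t (\<lambda>y. h1 y - h2 y) x = elliptic_op Q b t h1 x - elliptic_op Q b t h2 x"
proof -
  have 1: "partial i (\<lambda>y. h1 y - h2 y) = (\<lambda>x. partial i h1 x - partial i h2 x)" for i
    using assms by (auto simp: C2_def has_partial_diff(2))
  have 2: "partial i (partial j (\<lambda>y. h1 y - h2 y)) =
      (\<lambda>x. partial i (partial j h1) x - partial i (partial j h2) x)" for i j
    unfolding 1 using assms by (auto simp: C2_def has_partial_diff(2))
  show "C2 (\<lambda>y. h1 y - h2 y)"
    unfolding C2_def 2 unfolding 1
    using assms by (auto simp: C2_def intro!: has_partial_diff(1) continuous_on_diff)
  show "elliptic_op Q b t (\<lambda>y. h1 y - h2 y) x = elliptic_op Q b t h1 x - elliptic_op Q b t h2 x"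
    unfolding elliptic_op_def 2 unfolding 1 by (simp add: sum_subtractf algebra_simps)
qed

lemma C2_cmult:
  assumes "C2 h"
  shows "C2 (\<lambda>y. K * h y)"
    and "elliptic_op Q b t (\<lambda>y. K * h y) x = K * elliptic_op Q b t h x"
proof -
  have 1: "partial i (\<lambda>y. K * h y) = (\<lambda>x. K * partial i h x)" for i
    using assms by (auto simp: C2_def has_partial_cmult(2))
  have 2: "partial i (partial j (\<lambda>y. K * h y)) = (\<lambda>x. K * partial i (partial j h) x)" for i j
    unfolding 1 using assms by (auto simp: C2_def has_partial_cmult(2))
  show "C2 (\<lambda>y. K * h y)"
    unfolding C2_def 2 unfolding 1
    using assms by (auto simp: C2_def intro!: has_partial_cmult(1) continuous_on_mult_left)
  show "elliptic_op Q b t (\<lambda>y. K * h y) x = K * elliptic_op Q b t h x"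
    unfolding elliptic_op_def 2 unfolding 1 by (simp add: sum_distrib_left algebra_simps)
qed

lemma continuous_on_Times_slice:
  assumes "continuous_on (T \<times> UNIV) (\<lambda>(t, x). u t x)" "t \<in> T"
  shows "continuous_on UNIV (u t)"
proof -
  have "continuous_on UNIV ((\<lambda>(t, x). u t x) \<circ> (\<lambda>x. (t, x)))"
    by (rule continuous_on_compose[OF _ continuous_on_subset[OF assms(1)]])
      (use assms(2) in \<open>auto intro!: continuous_intros\<close>)
  then show ?thesis by (simp add: o_def)
qed

lemma C12_C2:
  assumes "C12 T u" "t \<in> T"
  shows "C2 (u t)"
proof -
  have "continuous_on UNIV (u t)"
    by (rule continuous_on_Times_slice[OF _ assms(2)]) (use assms(1) in \<open>simp add: C12_def\<close>)
  moreover have "continuous_on UNIV (partial i (u t))" for i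
    by (rule continuous_on_Times_slice[where u = "\<lambda>t. partial i (u t)", OF _ assms(2)])
      (use assms(1) in \<open>simp add: C12_def\<close>)
  moreover have "continuous_on UNIV (partial i (partial j (u t)))" for i j
    by (rule continuous_on_Times_slice[where u = "\<lambda>t. partial i (partial j (u t))", OF _ assms(2)])
      (use assms(1) in \<open>simp add: C12_def\<close>)
  ultimately show ?thesis
    using assms by (auto simp: C12_def C2_def)
qed

lemma C12_diff:
  assumes "C12 T u" "C12 T v"
  shows "C12 T (\<lambda>t x. u t x - v t x)"
proof -
  have 0: "deriv (\<lambda>\<tau>. u \<tau> x - v \<tau> x) t = deriv (\<lambda>\<tau>. u \<tau> x) t - deriv (\<lambda>\<tau>. v \<tau> x) t"
    if "t \<in> T" for t x
    using assms that by (intro deriv_diff) (auto simp: C12_def)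
  have 1: "partial i (\<lambda>y. u t y - v t y) = (\<lambda>x. partial i (u t) x - partial i (v t) x)"
    if "t \<in> T" for t i
    using assms that by (auto simp: C12_def has_partial_diff(2))
  have 2: "partial i (partial j (\<lambda>y. u t y - v t y)) =
      (\<lambda>x. partial i (partial j (u t)) x - partial i (partial j (v t)) x)" if "t \<in> T" for t i j
    unfolding 1[OF that] using assms that by (auto simp: C12_def has_partial_diff(2))
  have diff: "continuous_on (T \<times> UNIV) (\<lambda>(t, x). F t x)"
    if "continuous_on (T \<times> UNIV) (\<lambda>(t, x). F1 t x)" "continuous_on (T \<times> UNIV) (\<lambda>(t, x). F2 t x)"
      "\<And>t x. t \<in> T \<Longrightarrow> F t x = F1 t x - F2 t x" for F F1 F2 :: "real \<Rightarrow> real^'a \<Rightarrow> real"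
    using continuous_on_diff[OF that(1,2)] that(3)
    by (subst continuous_on_cong[OF refl, of _ _ "\<lambda>q. (case q of (t, x) \<Rightarrow> F1 t x) - (case q of (t, x) \<Rightarrow> F2 t x)"]) auto
  show ?thesis
    unfolding C12_def
  proof (intro conjI allI ballI)
    show "continuous_on (T \<times> UNIV) (\<lambda>(t, x). u t x - v t x)"
      by (rule diff[where ?F1.0 = u and ?F2.0 = v]) (use assms in \<open>auto simp: C12_def\<close>)
    show "continuous_on (T \<times> UNIV) (\<lambda>(t, x). deriv (\<lambda>\<tau>. u \<tau> x - v \<tau> x) t)"
      by (rule diff[where ?F1.0 = "\<lambda>t x. deriv (\<lambda>\<tau>. u \<tau> x) t" and ?F2.0 = "\<lambda>t x. deriv (\<lambda>\<tau>. v \<tau> x) t"])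
        (use assms 0 in \<open>auto simp: C12_def\<close>)
    show "continuous_on (T \<times> UNIV) (\<lambda>(t, x). partial i (\<lambda>x. u t x - v t x) x)" for i
      by (rule diff[where ?F1.0 = "\<lambda>t. partial i (u t)" and ?F2.0 = "\<lambda>t. partial i (v t)"])
        (use assms 1 in \<open>auto simp: C12_def\<close>)
    show "continuous_on (T \<times> UNIV) (\<lambda>(t, x). partial i (partial j (\<lambda>x. u t x - v t x)) x)" for i j
      by (rule diff[where ?F1.0 = "\<lambda>t. partial i (partial j (u t))" and ?F2.0 = "\<lambda>t. partial i (partial j (v t))"])
        (use assms 2 in \<open>auto simp: C12_def\<close>)
    show "(\<lambda>\<tau>. u \<tau> x - v \<tau> x) field_differentiable at t" if "t \<in> T" for t x
      using assms that by (intro field_differentiable_diff) (auto simp: C12_def)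
    show "has_partial i (\<lambda>x. u t x - v t x) x" if "t \<in> T" for t x i
      using assms that by (intro has_partial_diff) (auto simp: C12_def)
    show "has_partial i (partial j (\<lambda>x. u t x - v t x)) x" if "t \<in> T" for t x i j
      unfolding 1[OF that] using assms that by (intro has_partial_diff) (auto simp: C12_def)
  qed
qed

lemma C12_subset:
  assumes "C12 T u" "T' \<subseteq> T"
  shows "C12 T' u"
  using assms unfolding C12_def
  by (meson Sigma_mono continuous_on_subset order_refl subsetD)

text \<open>Makes the comparison principle applicable to differences of two evolutions. With
  \<open>u = v\<close> it also yields the zero solution.\<close>

lemma bounded_classical_solution_diff:
  assumes u: "bounded_classical_solution Q b s f1 u" and v: "bounded_classical_solution Q b s f2 v"
  shows "bounded_classical_solution Q b s (\<lambda>x. f1 x - f2 x) (\<lambda>t x. u t x - v t x)"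
  unfolding bounded_classical_solution_def
proof (intro conjI allI impI)
  show "continuous_on ({s..} \<times> UNIV) (\<lambda>(t, x). u t x - v t x)"
    using continuous_on_diff[of "{s..} \<times> UNIV" "\<lambda>(t, x). u t x" "\<lambda>(t, x). v t x"] u v
    by (simp add: bounded_classical_solution_def case_prod_unfold)
  show "bounded ((\<lambda>(t, x). u t x - v t x) ` ({s..} \<times> UNIV))"
    using bounded_minus_comp[of "\<lambda>(t, x). u t x" "{s..} \<times> UNIV" "\<lambda>(t, x). v t x"] u v
    by (simp add: bounded_classical_solution_def case_prod_unfold)
  show "C12 {s<..} (\<lambda>t x. u t x - v t x)"
    using u v by (intro C12_diff) (auto simp: bounded_classical_solution_def)
  show "deriv (\<lambda>\<tau>. u \<tau> x - v \<tau> x) t = elliptic_op Q b t (\<lambda>x. u t x - v t x) x" if "s < t" for t x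
  proof -
    have "C12 {s<..} u" "C12 {s<..} v"
      using u v by (auto simp: bounded_classical_solution_def)
    then have "deriv (\<lambda>\<tau>. u \<tau> x - v \<tau> x) t = deriv (\<lambda>\<tau>. u \<tau> x) t - deriv (\<lambda>\<tau>. v \<tau> x) t"
      using that by (intro deriv_diff) (auto simp: C12_def)
    also have "\<dots> = elliptic_op Q b t (u t) x - elliptic_op Q b t (v t) x"
      using u v that by (auto simp: bounded_classical_solution_def)
    also have "\<dots> = elliptic_op Q b t (\<lambda>x. u t x - v t x) x"
      using \<open>C12 {s<..} u\<close> \<open>C12 {s<..} v\<close> that by (intro C2_diff(2)[symmetric] C12_C2) auto
    finally show ?thesis .
  qed
  show "u s x - v s x = f1 x - f2 x" for x
    using u v by (auto simp: bounded_classical_solution_def)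
qed

text \<open>Allows a solution started at \<open>s\<close> to be compared with one started at a later
  time \<open>r\<close>.\<close>

lemma bounded_classical_solution_restrict:
  assumes u: "bounded_classical_solution Q b s f u" and "s \<le> r"
  shows "bounded_classical_solution Q b r (u r) u"
  unfolding bounded_classical_solution_def
proof (intro conjI)
  have sub: "{r..} \<times> (UNIV :: (real^'a) set) \<subseteq> {s..} \<times> UNIV" using assms(2) by auto
  show "continuous_on ({r..} \<times> UNIV) (\<lambda>(t, x). u t x)"
    using u sub unfolding bounded_classical_solution_def by (blast intro: continuous_on_subset)
  show "bounded ((\<lambda>(t, x). u t x) ` ({r..} \<times> UNIV))"
    using u sub unfolding bounded_classical_solution_def by (blast intro: bounded_subset image_mono)
  show "C12 {r<..} u"
    using u assms(2) unfolding bounded_classical_solution_def by (blast intro: C12_subset greaterThan_subset_iff[THEN iffD2])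
qed (use assms in \<open>auto simp: bounded_classical_solution_def\<close>)

section \<open>Comparison by means of a Lyapunov function\<close>

lemma filterlim_at_top_imp_bounded_sublevel:
  fixes \<phi> :: "'a::real_normed_vector \<Rightarrow> real"
  assumes "filterlim \<phi> at_top at_infinity"
  shows "bounded {x. \<phi> x \<le> C}"
proof -
  have "\<forall>\<^sub>F x in at_infinity. \<phi> x > C"
    using assms by (simp add: filterlim_at_top_dense)
  then obtain R where R: "\<And>x. norm x \<ge> R \<Longrightarrow> \<phi> x > C"
    unfolding eventually_at_infinity by blast
  then have "norm x \<le> R" if "\<phi> x \<le> C" for x
    using that by (metis linorder_not_less order_less_imp_le)
  then show ?thesis unfolding bounded_iff by blast
qed

locale lyapunov =
  fixes J :: "real set"
    and Q :: "real \<Rightarrow> real^'d \<Rightarrow> real^'d^'d"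
    and b :: "real \<Rightarrow> real^'d \<Rightarrow> real^'d::finite"
    and \<phi> :: "real^'d \<Rightarrow> real"
    and a :: real
  assumes symmetric: "t \<in> J \<Longrightarrow> transpose (Q t x) = Q t x"
    and positive: "t \<in> J \<Longrightarrow> \<xi> \<noteq> 0 \<Longrightarrow> (Q t x *v \<xi>) \<bullet> \<xi> > 0"
    and C2_lyapunov: "C2 \<phi>"
    and lyapunov_nonneg: "\<phi> x \<ge> 0"
    and a_nonneg: "a \<ge> 0"
    and lyapunov_at_top: "filterlim \<phi> at_top at_infinity"
    and lyapunov_bound: "t \<in> J \<Longrightarrow> elliptic_op Q b t \<phi> x \<le> a"
begin

text \<open>Maximum principle: \<open>M + K (\<phi>(x) + a (t - s))\<close> is a supersolution; enlarging \<open>K\<close> by \<open>\<epsilon>\<close>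
  makes it dominate \<open>u\<close> near infinity, so that the difference attains its maximum.\<close>

lemma comparison:
  assumes u: "bounded_classical_solution Q b s f u" and J: "{s..} \<subseteq> J"
    and K: "K \<ge> 0" and f: "\<And>x. f x \<le> M + K * \<phi> x" and t: "s \<le> t"
  shows "u t x \<le> M + K * (\<phi> x + a * (t - s))"
proof -
  \<comment> \<open>Two kinds of slack: \<open>K' > K\<close> makes the supersolution win at
    infinity even if \<open>K = 0\<close>, and the extra slope \<epsilon> in time makes the
    differential inequality strict.\<close>
  have strict: "u t x \<le> M + K' * \<phi> x + (K' * a + \<epsilon>) * (t - s)" if K': "K' > K" and \<epsilon>: "\<epsilon> > 0" for K' \<epsilon>
  proof (rule ccontr)
    define w where "w = (\<lambda>\<tau> y. u \<tau> y - M - K' * \<phi> y - (K' * a + \<epsilon>) * (\<tau> - s))"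
    assume "\<not> ?thesis"
    then have wpos: "w t x > 0" by (simp add: w_def)
    have K'pos: "K' > 0" using K K' by simp
    have cu: "continuous_on ({s..} \<times> UNIV) (\<lambda>(t, x). u t x)" and
      bu: "bounded ((\<lambda>(t, x). u t x) ` ({s..} \<times> UNIV))" and
      C12u: "C12 {s<..} u" and u0: "\<And>x. u s x = f x" and
      eq: "\<And>t x. t > s \<Longrightarrow> deriv (\<lambda>\<tau>. u \<tau> x) t = elliptic_op Q b t (u t) x"
      using u by (auto simp: bounded_classical_solution_def)
    obtain B where B: "\<And>\<tau> y. \<tau> \<ge> s \<Longrightarrow> \<bar>u \<tau> y\<bar> \<le> B"
      using bu unfolding bounded_iff by fastforce
    have c\<phi>: "continuous_on UNIV \<phi>" using C2_lyapunov by (simp add: C2_def)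
    \<comment> \<open>Off \<open>L\<close> the term \<open>K' * \<phi> y\<close> exceeds
      \<open>B - M\<close>, with \<open>B\<close> a bound for \<open>u\<close>, so \<open>w\<close>
      is nonpositive there and a positive maximum has to be sought only over a compact set.\<close>
    define L where "L = closure {y. \<phi> y \<le> (B - M) / K'}"
    have L: "compact L"
      unfolding L_def by (simp add: compact_closure filterlim_at_top_imp_bounded_sublevel[OF lyapunov_at_top])
    have neg: "w \<tau> y \<le> 0" if "y \<notin> L" "s \<le> \<tau>" for \<tau> y
    proof -
      have "\<phi> y > (B - M) / K'"
        using that(1) closure_subset unfolding L_def by (metis (mono_tags) mem_Collect_eq not_less subsetD)
      then have "K' * \<phi> y \<ge> B - M"
        using K'pos by (simp add: field_simps)
      moreover have "(K' * a + \<epsilon>) * (\<tau> - s) \<ge> 0"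
        using K'pos a_nonneg \<epsilon> that(2) by simp
      ultimately show ?thesis
        using B[OF that(2), of y] by (simp add: w_def)
    qed
    have "x \<in> L" using neg[of x t] t wpos by force
    have "continuous_on ({s..t} \<times> L) (\<lambda>(\<tau>, y). w \<tau> y)"
      unfolding w_def case_prod_unfold
      by (intro continuous_intros continuous_on_subset[OF cu[unfolded case_prod_unfold]]
          continuous_on_compose2[OF c\<phi>]) auto
    moreover have "compact ({s..t} \<times> L)" "{s..t} \<times> L \<noteq> {}"
      using L t \<open>x \<in> L\<close> by (auto intro: compact_Times)
    ultimately obtain t0 x0 where t0: "t0 \<in> {s..t}" "x0 \<in> L"
      and max: "\<And>\<tau> y. \<tau> \<in> {s..t} \<Longrightarrow> y \<in> L \<Longrightarrow> w \<tau> y \<le> w t0 x0"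
      using continuous_attains_sup[of "{s..t} \<times> L" "\<lambda>(\<tau>, y). w \<tau> y"] by fastforce
    have w0: "w t0 x0 > 0" using max[of t x] t \<open>x \<in> L\<close> wpos by auto
    have "w s x0 \<le> 0"
    proof -
      have "K * \<phi> x0 \<le> K' * \<phi> x0" using K' lyapunov_nonneg by (intro mult_right_mono) auto
      then show ?thesis using f[of x0] by (simp add: w_def u0)
    qed
    \<comment> \<open>The initial inequality excludes a positive maximum at time \<open>s\<close>,
      so the equation is available at \<open>t0\<close>.\<close>
    then have st0: "s < t0" using w0 t0 by (cases "s = t0") auto
    then have t0J: "t0 \<in> J" using J by auto
    have C2u: "C2 (u t0)" using C12_C2[OF C12u] st0 by simp
    have "elliptic_op Q b t0 (\<lambda>y. u t0 y - K' * \<phi> y) x0 \<le> 0"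
    proof (rule elliptic_op_at_max_nonpos)
      show "C2 (\<lambda>y. u t0 y - K' * \<phi> y)" by (intro C2_diff C2u C2_cmult C2_lyapunov)
      \<comment> \<open>The remaining terms of \<open>w\<close> do not depend on \<open>y\<close>,
        and \<open>w t0 y \<le> 0 < w t0 x0\<close> off \<open>L\<close>, so the maximum over
        \<open>L\<close> is global in space.\<close>
      show "u t0 y - K' * \<phi> y \<le> u t0 x0 - K' * \<phi> x0" for y
      proof -
        have "w t0 y \<le> w t0 x0"
          using max[of t0 y] neg[of y t0] t0 w0 by (cases "y \<in> L") auto
        then show ?thesis by (simp add: w_def)
      qed
    qed (use symmetric positive t0J in auto)
    then have "elliptic_op Q b t0 (u t0) x0 \<le> K' * elliptic_op Q b t0 \<phi> x0"
      by (simp add: C2_diff(2)[OF C2u C2_cmult(1)[OF C2_lyapunov]] C2_cmult(2)[OF C2_lyapunov])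
    also have "\<dots> \<le> K' * a"
      using K'pos lyapunov_bound[OF t0J] by (intro mult_left_mono) auto
    finally have D: "deriv (\<lambda>\<tau>. u \<tau> x0) t0 \<le> K' * a" using eq[OF st0] by simp
    have "((\<lambda>\<tau>. u \<tau> x0) has_real_derivative deriv (\<lambda>\<tau>. u \<tau> x0) t0) (at t0)"
      using C12u st0 by (auto simp: C12_def intro: field_differentiable_derivI)
    then have "((\<lambda>\<tau>. w \<tau> x0) has_real_derivative deriv (\<lambda>\<tau>. u \<tau> x0) t0 - (K' * a + \<epsilon>)) (at t0)"
      unfolding w_def by (auto intro!: derivative_eq_intros)
    \<comment> \<open>The time derivative of \<open>w\<close> is at most -\<epsilon>, so
      \<open>w\<close> was larger slightly earlier. Looking to the left is essential, since
      \<open>t0\<close> may be the right end point \<open>t\<close>.\<close>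
    from DERIV_neg_dec_left[OF this] D \<epsilon>
    obtain d where d: "d > 0" "\<And>h. h > 0 \<Longrightarrow> h < d \<Longrightarrow> w t0 x0 < w (t0 - h) x0" by force
    define h where "h = min (d / 2) (t0 - s)"
    have "w t0 x0 < w (t0 - h) x0" using d st0 by (intro d) (auto simp: h_def)
    moreover have "w (t0 - h) x0 \<le> w t0 x0"
      using d t0 st0 by (intro max) (auto simp: h_def)
    ultimately show False by simp
  qed
  \<comment> \<open>Both kinds of slack are tied to one parameter \<epsilon>, which tends to
    0.\<close>
  have "((\<lambda>\<epsilon>. M + (K + \<epsilon>) * \<phi> x + ((K + \<epsilon>) * a + \<epsilon>) * (t - s)) \<longlongrightarrow>
      M + (K + 0) * \<phi> x + ((K + 0) * a + 0) * (t - s)) (at_right 0)"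
    by (intro tendsto_intros)
  moreover have "\<forall>\<^sub>F \<epsilon> in at_right 0. u t x \<le> M + (K + \<epsilon>) * \<phi> x + ((K + \<epsilon>) * a + \<epsilon>) * (t - s)"
    using strict by (auto simp: eventually_at_right_less eventually_mono[OF eventually_at_right_less])
  ultimately have "u t x \<le> M + (K + 0) * \<phi> x + ((K + 0) * a + 0) * (t - s)"
    by (rule tendsto_lowerbound) simp
  then show ?thesis by (simp add: algebra_simps)
qed

lemma comparison_abs:
  assumes u: "bounded_classical_solution Q b s f u" and J: "{s..} \<subseteq> J"
    and K: "K \<ge> 0" and f: "\<And>x. \<bar>f x\<bar> \<le> M + K * \<phi> x" and t: "s \<le> t"
  shows "\<bar>u t x\<bar> \<le> M + K * (\<phi> x + a * (t - s))"
proof -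
  \<comment> \<open>The zero solution arises as \<open>u - u\<close>, and \<open>-u\<close> as zero
    minus \<open>u\<close>; \<open>comparison\<close> applied to \<open>u\<close> and
    \<open>-u\<close> gives both bounds.\<close>
  have "bounded_classical_solution Q b s (\<lambda>x. 0) (\<lambda>t x. 0)"
    using bounded_classical_solution_diff[OF u u] by simp
  from bounded_classical_solution_diff[OF this u]
  have v: "bounded_classical_solution Q b s (\<lambda>x. - f x) (\<lambda>t x. - u t x)" by simp
  show ?thesis
    unfolding abs_le_iff using f
    by (intro conjI comparison[OF u J K _ t] comparison[OF v J K _ t]) (auto simp: abs_le_iff)
qed

end

section \<open>The evolution operator and the mild solution\<close>

text \<open>A right-continuous function is the pointwise limit of its values at the next grid point
  to the right.\<close>

lemma borel_measurable_right_continuous: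
  fixes F :: "real \<Rightarrow> 'b::metric_space"
  assumes "\<And>r. (F \<longlongrightarrow> F r) (at_right r)"
  shows "F \<in> borel_measurable borel"
proof (rule borel_measurable_LIMSEQ_metric)
  \<comment> \<open>The grid has mesh \<open>1 / Suc n\<close>. Adding 1 after the floor makes
    \<open>a n r\<close> strictly larger than \<open>r\<close>, even at grid points, as convergence
    along \<open>at_right r\<close> requires. \<open>F (a n r)\<close> depends on \<open>r\<close>
    only through an integer and is thus measurable.\<close>
  define a where "a = (\<lambda>n r. (real_of_int \<lfloor>r * real (Suc n)\<rfloor> + 1) / real (Suc n))"
  show "(\<lambda>r. F (a n r)) \<in> borel_measurable borel" for n
    unfolding a_def
    by (rule measurable_compose[where N = "count_space UNIV" and f = "\<lambda>r. \<lfloor>r * real (Suc n)\<rfloor>"]) measurable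
  show "(\<lambda>n. F (a n r)) \<longlonglongrightarrow> F r" for r
  proof (rule filterlim_compose[OF assms])
    have gt: "r < a n r" and le: "a n r \<le> r + inverse (real (Suc n))" for n
    proof -
      have "r * real (Suc n) < real_of_int \<lfloor>r * real (Suc n)\<rfloor> + 1"
        "real_of_int \<lfloor>r * real (Suc n)\<rfloor> + 1 \<le> r * real (Suc n) + 1" by linarith+
      then show "r < a n r" "a n r \<le> r + inverse (real (Suc n))"
        unfolding a_def by (simp_all add: pos_less_divide_eq pos_divide_le_eq distrib_right del: of_nat_Suc)
    qed
    have "(\<lambda>n. r + inverse (real (Suc n))) \<longlonglongrightarrow> r"
      using tendsto_add[OF tendsto_const LIMSEQ_inverse_real_of_nat, of r] by simp
    then have "(\<lambda>n. a n r) \<longlonglongrightarrow> r"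
      by (rule tendsto_sandwich[OF _ _ tendsto_const, rotated 2])
        (use gt le in \<open>auto intro!: always_eventually less_imp_le simp del: of_nat_Suc\<close>)
    then show "filterlim (\<lambda>n. a n r) (at_right r) sequentially"
      unfolding filterlim_at using gt by (auto intro!: always_eventually less_imp_neq[symmetric])
  qed
qed

text \<open>Openness of \<open>J\<close> puts a compact ball around each point inside
  \<open>J\<close>, where the local Holder estimate applies.\<close>

lemma holder_loc_continuous_on:
  assumes h: "holder_loc \<beta> J h" and J: "open J" and \<beta>: "\<beta> > 0"
  shows "continuous_on J h"
proof (rule continuous_at_imp_continuous_on, rule ballI)
  fix t assume "t \<in> J"
  then obtain e where e: "e > 0" "cball t e \<subseteq> J"
    using J open_contains_cball by blast
  then obtain C where C: "\<And>r. r \<in> cball t e \<Longrightarrow> \<bar>h r - h t\<bar> \<le> C * \<bar>r - t\<bar> powr \<beta>"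
    using h unfolding holder_loc_def by (metis centre_in_cball compact_cball order_less_imp_le)
  have "((\<lambda>r. C * \<bar>r - t\<bar> powr \<beta>) \<longlongrightarrow> C * \<bar>t - t\<bar> powr \<beta>) (at t)"
    using \<beta> by (intro tendsto_intros) auto
  then have lim: "((\<lambda>r. C * \<bar>r - t\<bar> powr \<beta>) \<longlongrightarrow> 0) (at t)" using \<beta> by simp
  have "\<forall>\<^sub>F r in at t. norm (h r - h t) \<le> C * \<bar>r - t\<bar> powr \<beta>"
    unfolding eventually_at using e(1) C
    by (intro exI[of _ e]) (auto simp: dist_commute)
  from Lim_null_comparison[OF this lim] show "isCont h t"
    by (simp add: isCont_def Lim_null[symmetric])
qed

section \<open>The sup norm and its exponentially weighted version\<close>

lemma abs_le_sup_norm: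
  assumes "h \<in> bcontfun"
  shows "\<bar>h x\<bar> \<le> sup_norm h"
proof -
  have "bounded (range h)" using assms by (simp add: bcontfun_def)
  then have "bdd_above (range (\<lambda>x. \<bar>h x\<bar>))"
    by (auto simp: bounded_iff bdd_above_def)
  then show ?thesis unfolding sup_norm_def by (rule cSUP_upper[OF UNIV_I])
qed

lemma sup_norm_nonneg: "h \<in> bcontfun \<Longrightarrow> 0 \<le> sup_norm h"
  using abs_le_sup_norm[of h undefined] by linarith

lemma sup_norm_le:
  assumes "\<And>x. \<bar>h x\<bar> \<le> M"
  shows "sup_norm h \<le> M"
  unfolding sup_norm_def using assms by (intro cSUP_least) auto

text \<open>Replaces locally uniform continuity of \<open>v\<close> by joint continuity in time and
  space, the form in which it is proved and used below.\<close>

lemma C_omega_iff: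
  fixes v :: "real \<Rightarrow> 'a::heine_borel \<Rightarrow> real"
  shows "v \<in> C_omega \<omega> s \<longleftrightarrow> (\<forall>t\<ge>s. v t \<in> bcontfun) \<and>
    continuous_on ({s..} \<times> UNIV) (\<lambda>(t, x). v t x) \<and>
    bdd_above ((\<lambda>t. exp (\<omega> * (t - s)) * sup_norm (v t)) ` {s..})"
  using locally_uniform_continuous_iff[of s v]
  unfolding C_omega_def bcontfun_def by auto

lemma sup_norm_le_C_omega_norm:
  assumes "v \<in> C_omega \<omega> s" "s \<le> t"
  shows "sup_norm (v t) \<le> exp (- \<omega> * (t - s)) * C_omega_norm \<omega> s v"
proof -
  have "exp (\<omega> * (t - s)) * sup_norm (v t) \<le> C_omega_norm \<omega> s v"
    unfolding C_omega_norm_def using assms by (intro cSUP_upper) (auto simp: C_omega_def)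
  then have "exp (- \<omega> * (t - s)) * (exp (\<omega> * (t - s)) * sup_norm (v t))
      \<le> exp (- \<omega> * (t - s)) * C_omega_norm \<omega> s v"
    by (rule mult_left_mono) simp
  then show ?thesis by (simp add: mult.assoc[symmetric] flip: exp_add)
qed

section \<open>Contraction, decay and continuity of the evolution operators\<close>

locale dissipative_evolution = lyapunov J Q b \<phi> a
  for J :: "real set" and Q :: "real \<Rightarrow> real^'d \<Rightarrow> real^'d^'d"
    and b :: "real \<Rightarrow> real^'d \<Rightarrow> real^'d::finite" and \<phi> a +
  fixes G :: "real \<Rightarrow> real \<Rightarrow> (real^'d \<Rightarrow> real) \<Rightarrow> real^'d \<Rightarrow> real"
    and \<psi> :: "real \<Rightarrow> real \<Rightarrow> real"
    and \<omega>\<^sub>0 :: real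
  assumes evolution: "evolution_operator J Q b G"
    and upward: "r \<in> J \<Longrightarrow> {r..} \<subseteq> J"
    and deriv_continuous: "continuous_on J (\<lambda>t. deriv (\<psi> t) 0)"
    and deriv_le: "t \<in> J \<Longrightarrow> deriv (\<psi> t) 0 \<le> - \<omega>\<^sub>0"
begin

lemma G_solution:
  assumes "r \<in> J" "h \<in> bcontfun"
  shows "bounded_classical_solution Q b r h (\<lambda>t. G t r h)"
  using evolution assms by (auto simp: evolution_operator_def)

text \<open>The comparison bound with \<open>K = 0\<close>: constants are supersolutions.\<close>

lemma G_contraction:
  assumes "r \<in> J" "h \<in> bcontfun" "r \<le> t"
  shows "\<bar>G t r h x\<bar> \<le> sup_norm h"
  using comparison_abs[OF G_solution[OF assms(1,2)] upward[OF assms(1)] order_refl, of "sup_norm h"]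
    abs_le_sup_norm[OF assms(2)] assms(3) by simp

text \<open>For \<open>\<rho> > r\<close> the function \<open>\<tau> \<mapsto> G(\<tau>,\<rho>)g(\<rho>) - G(\<tau>,r)g(r)\<close> solves the equation from time
  \<open>\<rho>\<close> on; its initial value at \<open>\<rho>\<close> is small on compact sets as \<open>\<rho>\<close> decreases to \<open>r\<close> and bounded,
  hence below \<open>\<delta> + \<delta> \<phi>\<close> everywhere.\<close>

lemma G_tendsto_right:
  assumes r: "r \<in> J" "r < t"
    and g: "\<And>\<tau>. \<tau> \<ge> r \<Longrightarrow> g \<tau> \<in> bcontfun" "\<And>\<tau>. \<tau> \<ge> r \<Longrightarrow> sup_norm (g \<tau>) \<le> N"
    and cont: "continuous_on ({r..} \<times> UNIV) (\<lambda>(\<tau>, x). g \<tau> x)"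
  shows "((\<lambda>\<rho>. G t \<rho> (g \<rho>) x) \<longlongrightarrow> G t r (g r) x) (at_right r)"
proof (rule tendstoI)
  fix e :: real assume e: "e > 0"
  define C where "C = 1 + (\<phi> x + a * (t - r))"
  have C: "C > 0" using lyapunov_nonneg[of x] a_nonneg r by (simp add: C_def add_pos_nonneg)
  \<comment> \<open>Chosen so that the final bound \<open>\<delta> * C\<close> equals
    \<open>e / 2\<close>.\<close>
  define \<delta> where "\<delta> = e / (2 * C)"
  have \<delta>: "\<delta> > 0" using e C by (simp add: \<delta>_def)
  define v where "v = (\<lambda>\<tau>. G \<tau> r (g r))"
  have v: "bounded_classical_solution Q b r (g r) v"
    unfolding v_def using r g by (intro G_solution) auto
  have vr: "v r = g r" and cv: "continuous_on ({r..} \<times> UNIV) (\<lambda>(\<tau>, x). v \<tau> x)"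
    using v by (auto simp: bounded_classical_solution_def)
  \<comment> \<open>Off \<open>L\<close> one has \<open>2 * N \<le> \<delta> * \<phi> y\<close>, so
    the crude bound \<open>N\<close> for each of \<open>g \<rho>\<close> and \<open>v \<rho>\<close>
    suffices. On \<open>L\<close> uniform convergence is used.\<close>
  define L where "L = closure {y. \<phi> y \<le> 2 * N / \<delta>}"
  have L: "compact L"
    unfolding L_def by (simp add: compact_closure filterlim_at_top_imp_bounded_sublevel[OF lyapunov_at_top])
  \<comment> \<open>Used for \<open>g\<close> and for \<open>v\<close>; both take the value
    \<open>g r\<close> at time \<open>r\<close>, so together they differ by less than \<delta> on
    \<open>L\<close>.\<close>
  have near: "\<forall>\<^sub>F \<rho> in at_right r. \<forall>y\<in>L. dist (w \<rho> y) (w r y) < \<delta> / 2"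
    if "continuous_on ({r..} \<times> UNIV) (\<lambda>(\<tau>, x). w \<tau> x)" for w :: "real \<Rightarrow> real^'d \<Rightarrow> real"
  proof -
    have "uniform_limit L w (w r) (at r within {r..})"
      using that L locally_uniform_continuous_iff[of r w] continuous_on_Times_slice[OF that] by auto
    then have "uniform_limit L w (w r) (at_right r)"
      by (rule filterlim_mono[OF _ order_refl]) (auto intro: at_le)
    then show ?thesis using \<delta> by (auto dest: uniform_limitD[of _ _ _ _ "\<delta> / 2"])
  qed
  have "\<forall>\<^sub>F \<rho> in at_right r. r < \<rho> \<and> \<rho> < t"
    using r eventually_at_right_real by (auto elim: eventually_mono)
  then show "\<forall>\<^sub>F \<rho> in at_right r. dist (G t \<rho> (g \<rho>) x) (G t r (g r) x) < e"
    using near[OF cont] near[OF cv]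
  proof eventually_elim
    case (elim \<rho>)
    have \<rho>: "\<rho> \<in> J" using elim upward[OF r(1)] by auto
    have w: "bounded_classical_solution Q b \<rho> (\<lambda>y. g \<rho> y - v \<rho> y) (\<lambda>\<tau> y. G \<tau> \<rho> (g \<rho>) y - v \<tau> y)"
      using elim \<rho> g by (intro bounded_classical_solution_diff G_solution
          bounded_classical_solution_restrict[OF v]) auto
    have init: "\<bar>g \<rho> y - v \<rho> y\<bar> \<le> \<delta> + \<delta> * \<phi> y" for y
    proof (cases "y \<in> L")
      case True
      then have "\<bar>g \<rho> y - v \<rho> y\<bar> \<le> \<delta>"
        using bspec[OF elim(2) True] bspec[OF elim(3) True]
        unfolding dist_real_def vr by linarith
      then show ?thesis using \<delta> lyapunov_nonneg[of y] by (simp add: add_increasing2)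
    next
      case False
      then have "\<phi> y > 2 * N / \<delta>"
        using closure_subset unfolding L_def by (metis (mono_tags) mem_Collect_eq not_less subsetD)
      then have "2 * N \<le> \<delta> * \<phi> y" using \<delta> by (simp add: field_simps)
      moreover have "\<bar>g \<rho> y\<bar> \<le> N"
        using abs_le_sup_norm[OF g(1), of \<rho> y] g(2)[of \<rho>] elim by simp
      moreover have "\<bar>v \<rho> y\<bar> \<le> N"
        using G_contraction[OF r(1) g(1), of r \<rho> y] g(2)[of r] elim by (simp add: v_def)
      ultimately show ?thesis using \<delta> by linarith
    qed
    have "\<bar>G t \<rho> (g \<rho>) x - v t x\<bar> \<le> \<delta> + \<delta> * (\<phi> x + a * (t - \<rho>))"
      by (rule comparison_abs[OF w upward[OF \<rho>] _ init]) (use elim \<delta> in auto)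
    also have "\<dots> \<le> \<delta> + \<delta> * (\<phi> x + a * (t - r))"
      using elim \<delta> a_nonneg by (intro add_left_mono mult_left_mono) auto
    also have "\<dots> = \<delta> * C" by (simp add: C_def algebra_simps)
    also have "\<dots> = e / 2" using C by (simp add: \<delta>_def)
    also have "\<dots> < e" using e by simp
    finally show ?case by (simp add: dist_real_def v_def)
  qed
qed

lemma deriv_integrable:
  assumes "r \<in> J"
  shows "(\<lambda>\<sigma>. deriv (\<psi> \<sigma>) 0) integrable_on {r..t}"
  using upward[OF assms]
  by (intro integrable_continuous_real continuous_on_subset[OF deriv_continuous]) auto

lemma exp_integral_le:
  assumes "r \<in> J" "r \<le> t"
  shows "exp (integral {r..t} (\<lambda>\<sigma>. deriv (\<psi> \<sigma>) 0)) \<le> exp (- \<omega>\<^sub>0 * (t - r))"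
proof -
  have "integral {r..t} (\<lambda>\<sigma>. deriv (\<psi> \<sigma>) 0) \<le> integral {r..t} (\<lambda>\<sigma>. - \<omega>\<^sub>0)"
    using upward[OF assms(1)]
    by (intro integral_le deriv_integrable assms deriv_le) auto
  then show ?thesis using assms(2) by (simp add: algebra_simps)
qed

lemma B_decay:
  assumes "r \<in> J" "h \<in> bcontfun" "r \<le> t"
  shows "\<bar>evolution_operator_B \<psi> G t r h x\<bar> \<le> exp (- \<omega>\<^sub>0 * (t - r)) * sup_norm h"
  unfolding evolution_operator_B_def abs_mult abs_exp_cancel
  using assms by (intro mult_mono exp_integral_le G_contraction) auto

lemma B_continuous_on:
  assumes "r \<in> J" "h \<in> bcontfun"
  shows "continuous_on ({r..} \<times> UNIV) (\<lambda>(t, x). evolution_operator_B \<psi> G t r h x)"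
proof -
  have 1: "continuous_on ({r..} \<times> UNIV) (\<lambda>q. G (fst q) r h (snd q))"
    using G_solution[OF assms] by (simp add: bounded_classical_solution_def case_prod_unfold)
  have "continuous_on {r..} (\<lambda>t. integral {r..t} (\<lambda>\<sigma>. deriv (\<psi> \<sigma>) 0))"
    unfolding continuous_on_eq_continuous_within
  proof
    fix t assume t: "t \<in> {r..}"
    have "continuous_on {r..t + 1} (\<lambda>t. integral {r..t} (\<lambda>\<sigma>. deriv (\<psi> \<sigma>) 0))"
      by (intro indefinite_integral_continuous_1 deriv_integrable assms)
    then have "continuous (at t within {r..t + 1}) (\<lambda>t. integral {r..t} (\<lambda>\<sigma>. deriv (\<psi> \<sigma>) 0))"
      using t by (simp add: continuous_on_eq_continuous_within)
    \<comment> \<open>Continuity of an indefinite integral is known on compact intervals; ending the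
      interval at \<open>t + 1\<close> leaves the neighbourhoods of \<open>t\<close> in
      \<open>{r..}\<close> unaffected.\<close>
    moreover have "at t within {r..t + 1} = at t within {r..}"
      by (rule at_within_nhd[of _ "{..<t + 1}"]) auto
    ultimately show "continuous (at t within {r..}) (\<lambda>t. integral {r..t} (\<lambda>\<sigma>. deriv (\<psi> \<sigma>) 0))"
      by simp
  qed
  then have "continuous_on ({r..} \<times> (UNIV :: (real^'d) set))
      (\<lambda>q. integral {r..fst q} (\<lambda>\<sigma>. deriv (\<psi> \<sigma>) 0))"
    by (rule continuous_on_compose2) (auto intro: continuous_intros)
  then show ?thesis
    unfolding evolution_operator_B_def case_prod_unfold
    by (intro continuous_on_mult continuous_on_exp 1)
qed

lemma B_tendsto_right:
  assumes r: "r \<in> J" "r < t"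
    and g: "\<And>\<tau>. \<tau> \<ge> r \<Longrightarrow> g \<tau> \<in> bcontfun" "\<And>\<tau>. \<tau> \<ge> r \<Longrightarrow> sup_norm (g \<tau>) \<le> N"
    and cont: "continuous_on ({r..} \<times> UNIV) (\<lambda>(\<tau>, x). g \<tau> x)"
  shows "((\<lambda>\<rho>. evolution_operator_B \<psi> G t \<rho> (g \<rho>) x) \<longlongrightarrow> evolution_operator_B \<psi> G t r (g r) x) (at_right r)"
  unfolding evolution_operator_B_def
proof (intro tendsto_mult tendsto_exp G_tendsto_right[OF assms])
  have "continuous_on {r..t} (\<lambda>\<rho>. integral {\<rho>..t} (\<lambda>\<sigma>. deriv (\<psi> \<sigma>) 0))"
    by (intro indefinite_integral_continuous_1' deriv_integrable r)
  then have "((\<lambda>\<rho>. integral {\<rho>..t} (\<lambda>\<sigma>. deriv (\<psi> \<sigma>) 0)) \<longlongrightarrow> integral {r..t} (\<lambda>\<sigma>. deriv (\<psi> \<sigma>) 0))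
      (at r within {r..t})"
    using r by (auto simp: continuous_on_def)
  then show "((\<lambda>\<rho>. integral {\<rho>..t} (\<lambda>\<sigma>. deriv (\<psi> \<sigma>) 0)) \<longlongrightarrow> integral {r..t} (\<lambda>\<sigma>. deriv (\<psi> \<sigma>) 0)) (at_right r)"
    using r by (simp add: at_within_Icc_at_right)
qed

end

section \<open>The integral term and the weighted estimate of the mild solution\<close>

locale mild_problem = dissipative_evolution J Q b \<phi> a G \<psi> \<omega>\<^sub>0
  for J :: "real set" and Q :: "real \<Rightarrow> real^'d \<Rightarrow> real^'d^'d"
    and b :: "real \<Rightarrow> real^'d \<Rightarrow> real^'d::finite" and \<phi> a G \<psi> \<omega>\<^sub>0 +
  fixes s \<omega> :: real and f :: "real^'d \<Rightarrow> real" and g :: "real \<Rightarrow> real^'d \<Rightarrow> real"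
  assumes s: "s \<in> J" and \<omega>: "0 \<le> \<omega>" "\<omega> < \<omega>\<^sub>0"
    and f: "f \<in> bcontfun" and g: "g \<in> C_omega \<omega> s"
begin

text \<open>The integrand of the mild solution, extended by zero. The half-open range makes it right
  continuous at every \<open>r\<close>: the end point \<open>t\<close> already belongs to the zero
  piece.\<close>

definition kernel :: "real \<Rightarrow> real^'d \<Rightarrow> real \<Rightarrow> real" where
  "kernel t x r = (if s \<le> r \<and> r < t then evolution_operator_B \<psi> G t r (g r) x else 0)"

abbreviation "N \<equiv> C_omega_norm \<omega> s g"

lemma g_bcontfun: "s \<le> r \<Longrightarrow> g r \<in> bcontfun"
  using g by (simp add: C_omega_def)

lemma g_decay: "s \<le> r \<Longrightarrow> sup_norm (g r) \<le> exp (- \<omega> * (r - s)) * N"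
  using sup_norm_le_C_omega_norm[OF g] .

lemma N_nonneg: "0 \<le> N"
proof -
  have "0 \<le> sup_norm (g s)" by (intro sup_norm_nonneg g_bcontfun) simp
  also have "\<dots> \<le> N" using g_decay[of s] by simp
  finally show ?thesis .
qed

lemma g_le: "s \<le> r \<Longrightarrow> sup_norm (g r) \<le> N"
  by (rule order_trans[OF g_decay]) (use N_nonneg \<omega> in \<open>auto intro!: mult_left_le_one_le\<close>)

lemma in_J: "s \<le> r \<Longrightarrow> r \<in> J"
  using upward[OF s] by auto

lemma kernel_decay:
  "\<bar>kernel t x r\<bar> \<le> (exp (- \<omega>\<^sub>0 * (t - r)) * (exp (- \<omega> * (r - s)) * N)) * indicator {s..t} r"
proof (cases "s \<le> r \<and> r < t")
  case True
  then have "\<bar>kernel t x r\<bar> \<le> exp (- \<omega>\<^sub>0 * (t - r)) * sup_norm (g r)"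
    using B_decay[OF in_J g_bcontfun, of r r t x] by (simp add: kernel_def)
  also have "\<dots> \<le> exp (- \<omega>\<^sub>0 * (t - r)) * (exp (- \<omega> * (r - s)) * N)"
    using True by (intro mult_left_mono g_decay) auto
  finally show ?thesis using True by simp
qed (use N_nonneg in \<open>auto simp: kernel_def\<close>)

text \<open>Bounding the exponentials by 1 gives up the decay but yields one integrable majorant for
  all \<open>t \<le> T\<close>, as dominated convergence needs.\<close>

lemma kernel_le:
  assumes "t \<le> T"
  shows "\<bar>kernel t x r\<bar> \<le> N * indicator {s..T} r"
proof (cases "s \<le> r \<and> r < t")
  case True
  then have "\<bar>kernel t x r\<bar> \<le> exp (- \<omega>\<^sub>0 * (t - r)) * sup_norm (g r)"
    using B_decay[OF in_J g_bcontfun, of r r t x] by (simp add: kernel_def)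
  also have "\<dots> \<le> 1 * N"
    using True \<omega> N_nonneg sup_norm_nonneg[OF g_bcontfun, of r]
    by (intro mult_mono g_le) (auto simp: mult_nonpos_nonneg)
  finally show ?thesis using True assms by simp
qed (use N_nonneg in \<open>auto simp: kernel_def\<close>)

lemma kernel_measurable [measurable]: "kernel t x \<in> borel_measurable borel"
proof (rule borel_measurable_right_continuous)
  fix r
  \<comment> \<open>Each break point belongs to the piece on its right, so in every case
    \<open>kernel\<close> is given by a single formula just to the right of
    \<open>r\<close>.\<close>
  consider "r < s" | "s \<le> r" "r < t" | "t \<le> r" by linarith
  then show "(kernel t x \<longlongrightarrow> kernel t x r) (at_right r)"
  proof cases
    case 1
    then have "\<forall>\<^sub>F \<rho> in at_right r. kernel t x \<rho> = kernel t x r"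
      using eventually_at_right_real[OF 1] by (auto elim!: eventually_mono simp: kernel_def)
    then show ?thesis by (rule tendsto_eventually)
  next
    case 2
    have "((\<lambda>\<rho>. evolution_operator_B \<psi> G t \<rho> (g \<rho>) x) \<longlongrightarrow> kernel t x r) (at_right r)"
      using 2 g unfolding C_omega_iff
      by (auto simp: kernel_def intro!: B_tendsto_right[where N = N] in_J g_bcontfun g_le
          elim!: continuous_on_subset)
    moreover have "\<forall>\<^sub>F \<rho> in at_right r. evolution_operator_B \<psi> G t \<rho> (g \<rho>) x = kernel t x \<rho>"
      using eventually_at_right_real[OF 2(2)] 2(1) by (auto elim!: eventually_mono simp: kernel_def)
    ultimately show ?thesis by (rule Lim_transform_eventually)
  next
    case 3
    then have "\<forall>\<^sub>F \<rho> in at_right r. kernel t x \<rho> = kernel t x r"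
      using eventually_at_right_less[of r] by (auto elim!: eventually_mono simp: kernel_def)
    then show ?thesis by (rule tendsto_eventually)
  qed
qed

lemma bound_integrable: "integrable lborel (\<lambda>r. N * indicator {s..t} r)"
  by (intro integrable_mult_right integrable_real_indicator) (auto simp: emeasure_lborel_Icc_eq)

lemma kernel_integrable: "integrable lborel (kernel t x)"
proof (rule Bochner_Integration.integrable_bound[OF bound_integrable])
qed (use kernel_le[of t t x] in \<open>auto intro!: always_eventually simp: N_nonneg\<close>)

text \<open>Passes from the gauge integral over \<open>{s..t}\<close> to a Lebesgue integral over
  the whole line, which no longer has a moving domain. The integrands differ only at the null set
  \<open>{t}\<close>.\<close>

lemma mild_solution_eq:
  "mild_solution \<psi> G s f g t x = evolution_operator_B \<psi> G t s f x + (\<integral>r. kernel t x r \<partial>lborel)"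
proof -
  have "integral {s..t} (\<lambda>r. evolution_operator_B \<psi> G t r (g r) x) = integral UNIV
      (\<lambda>r. if r \<in> {s..t} then evolution_operator_B \<psi> G t r (g r) x else 0)"
    by (rule Henstock_Kurzweil_Integration.integral_restrict_UNIV[symmetric])
  also have "\<dots> = integral UNIV (kernel t x)"
    by (rule integral_spike[of "{t}"]) (auto simp: kernel_def)
  also have "\<dots> = (\<integral>r. kernel t x r \<partial>lborel)"
    by (rule integral_lborel[OF kernel_integrable])
  finally show ?thesis by (simp add: mild_solution_def)
qed

lemma kernel_integral_continuous_on:
  "continuous_on ({s..} \<times> UNIV) (\<lambda>(t, x). \<integral>r. kernel t x r \<partial>lborel)"
proof (rule continuous_on_sequentiallyI)
  fix u :: "nat \<Rightarrow> real \<times> (real^'d)" and q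
  assume u: "\<forall>n. u n \<in> {s..} \<times> UNIV" and "q \<in> {s..} \<times> UNIV" and lim: "u \<longlonglongrightarrow> q"
  obtain t x where q: "q = (t, x)" by (cases q)
  have lt: "(\<lambda>n. fst (u n)) \<longlonglongrightarrow> t" using tendsto_fst[OF lim] q by simp
  then obtain T where "\<And>n. \<bar>fst (u n)\<bar> \<le> T"
    using convergent_imp_Bseq[OF convergentI[OF lt]] by (auto simp: Bseq_def)
  then have T: "fst (u n) \<le> T" for n using abs_le_D1 by blast
  have "(\<lambda>n. \<integral>r. kernel (fst (u n)) (snd (u n)) r \<partial>lborel) \<longlonglongrightarrow> (\<integral>r. kernel t x r \<partial>lborel)"
  proof (rule integral_dominated_convergence[where w = "\<lambda>r. N * indicator {s..T} r"])
    show "AE r in lborel. (\<lambda>n. kernel (fst (u n)) (snd (u n)) r) \<longlonglongrightarrow> kernel t x r"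
      \<comment> \<open>At \<open>r = t\<close> convergence may fail: the limit kernel is 0 there,
        while approximating times larger than \<open>t\<close> can give nonzero values.\<close>
      using AE_lborel_singleton[of t]
    proof eventually_elim
      case (elim r)
      consider "r < s" | "s \<le> r" "r < t" | "t < r" using elim by linarith
      then show ?case
      proof cases
        case 1
        then show ?thesis by (simp add: kernel_def)
      next
        case 2
        \<comment> \<open>From some index on \<open>r\<close> lies before the approximating times,
          so joint continuity of the evolution started at \<open>r\<close> applies.\<close>
        have ev: "\<forall>\<^sub>F n in sequentially. r < fst (u n)"
          using order_tendstoD(1)[OF lt 2(2)] .
        have "((\<lambda>n. (\<lambda>(t, x). evolution_operator_B \<psi> G t r (g r) x) (u n)) \<longlongrightarrow>
            (\<lambda>(t, x). evolution_operator_B \<psi> G t r (g r) x) q) sequentially"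
          by (rule continuous_on_tendsto_compose[OF B_continuous_on[OF in_J g_bcontfun] lim])
            (use 2 q ev in \<open>auto elim!: eventually_mono simp: mem_Times_iff\<close>)
        then have "(\<lambda>n. evolution_operator_B \<psi> G (fst (u n)) r (g r) (snd (u n))) \<longlonglongrightarrow> kernel t x r"
          using 2 q by (simp add: case_prod_unfold kernel_def)
        moreover have "\<forall>\<^sub>F n in sequentially.
            evolution_operator_B \<psi> G (fst (u n)) r (g r) (snd (u n)) = kernel (fst (u n)) (snd (u n)) r"
          using ev 2(1) by (auto elim!: eventually_mono simp: kernel_def)
        ultimately show ?thesis by (rule Lim_transform_eventually)
      next
        case 3
        have "\<forall>\<^sub>F n in sequentially. kernel (fst (u n)) (snd (u n)) r = kernel t x r"
          using order_tendstoD(2)[OF lt 3] 3 by (auto elim!: eventually_mono simp: kernel_def)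
        then show ?thesis by (rule tendsto_eventually)
      qed
    qed
  qed (use kernel_le[OF T] bound_integrable in \<open>auto intro!: always_eventually\<close>)
  then show "(\<lambda>n. case u n of (t, x) \<Rightarrow> \<integral>r. kernel t x r \<partial>lborel) \<longlonglongrightarrow>
      (case q of (t, x) \<Rightarrow> \<integral>r. kernel t x r \<partial>lborel)"
    by (simp add: q case_prod_unfold)
qed

lemma kernel_integral_decay:
  assumes t: "s \<le> t"
  shows "\<bar>\<integral>r. kernel t x r \<partial>lborel\<bar> \<le> exp (- \<omega> * (t - s)) * (1 / (\<omega>\<^sub>0 - \<omega>) * N)"
proof -
  define E where "E = (\<lambda>r. exp (- \<omega>\<^sub>0 * (t - r)) * (exp (- \<omega> * (r - s)) * N))"
  \<comment> \<open>Collecting exponents shows growth rate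
    \<open>\<omega>\<^sub>0 - \<omega> > 0\<close> in \<open>r\<close>, so
    \<open>E / (\<omega>\<^sub>0 - \<omega>)\<close> is a primitive; this is where the constant of
    the estimate comes from.\<close>
  have E': "E = (\<lambda>r. exp ((\<omega>\<^sub>0 - \<omega>) * r + (\<omega> * s - \<omega>\<^sub>0 * t)) * N)"
  proof
    fix r
    have "E r = exp (- \<omega>\<^sub>0 * (t - r) + - \<omega> * (r - s)) * N"
      by (simp only: E_def exp_add mult.assoc)
    also have "- \<omega>\<^sub>0 * (t - r) + - \<omega> * (r - s) = (\<omega>\<^sub>0 - \<omega>) * r + (\<omega> * s - \<omega>\<^sub>0 * t)"
      by (simp add: algebra_simps)
    finally show "E r = exp ((\<omega>\<^sub>0 - \<omega>) * r + (\<omega> * s - \<omega>\<^sub>0 * t)) * N" .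
  qed
  define F where "F = (\<lambda>r. E r / (\<omega>\<^sub>0 - \<omega>))"
  have F: "(F has_real_derivative E r) (at r)" for r
    unfolding F_def E' using \<omega>
    by (intro DERIV_cong[OF DERIV_cdivide[OF DERIV_cmult_right[OF DERIV_fun_exp[where m = "\<omega>\<^sub>0 - \<omega>"]]]])
      (auto intro!: derivative_eq_intros)
  have E_int: "has_bochner_integral lborel (\<lambda>r. E r * indicator {s..t} r) (F t - F s)"
    by (rule has_bochner_integral_FTC_Icc_real[OF t F]) (auto simp: E_def intro!: continuous_intros)
  have "\<bar>\<integral>r. kernel t x r \<partial>lborel\<bar> \<le> (\<integral>r. \<bar>kernel t x r\<bar> \<partial>lborel)"
    using integral_norm_bound[of lborel "kernel t x"] by simp
  also have "\<dots> \<le> (\<integral>r. E r * indicator {s..t} r \<partial>lborel)"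
    using kernel_decay[of t x] E_int kernel_integrable
    by (intro integral_mono) (auto simp: E_def has_bochner_integral_iff)
  also have "\<dots> = F t - F s"
    using E_int by (simp add: has_bochner_integral_iff)
  \<comment> \<open>The lower boundary term \<open>F s\<close> is nonnegative and is
    dropped.\<close>
  also have "\<dots> \<le> F t"
    using N_nonneg \<omega> by (simp add: F_def E_def)
  also have "\<dots> = exp (- \<omega> * (t - s)) * (1 / (\<omega>\<^sub>0 - \<omega>) * N)"
    by (simp add: F_def E_def)
  finally show ?thesis .
qed

lemma mild_solution_decay:
  assumes t: "s \<le> t"
  shows "\<bar>mild_solution \<psi> G s f g t x\<bar> \<le> exp (- \<omega> * (t - s)) * (sup_norm f + 1 / (\<omega>\<^sub>0 - \<omega>) * N)"
proof -
  have "\<bar>evolution_operator_B \<psi> G t s f x\<bar> \<le> exp (- \<omega>\<^sub>0 * (t - s)) * sup_norm f"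
    by (rule B_decay[OF s f t])
  \<comment> \<open>The initial datum decays at the faster rate \<open>\<omega>\<^sub>0\<close>,
    which is weakened to \<omega> to match the integral term.\<close>
  also have "\<dots> \<le> exp (- \<omega> * (t - s)) * sup_norm f"
    using t \<omega> sup_norm_nonneg[OF f] by (intro mult_right_mono) (auto simp: mult_right_mono)
  finally have "\<bar>evolution_operator_B \<psi> G t s f x\<bar> \<le> exp (- \<omega> * (t - s)) * sup_norm f" .
  with kernel_integral_decay[OF t, of x] show ?thesis
    unfolding mild_solution_eq distrib_left by linarith
qed

lemma mild_solution_continuous_on:
  "continuous_on ({s..} \<times> UNIV) (\<lambda>(t, x). mild_solution \<psi> G s f g t x)"
  using continuous_on_add[OF B_continuous_on[OF s f] kernel_integral_continuous_on]
  by (simp add: mild_solution_eq case_prod_unfold)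

lemma C_omega_mild_solution:
  assumes z: "\<And>t x. s \<le> t \<Longrightarrow> z t x = mild_solution \<psi> G s f g t x"
  shows "z \<in> C_omega \<omega> s" "C_omega_norm \<omega> s z \<le> sup_norm f + 1 / (\<omega>\<^sub>0 - \<omega>) * N"
proof -
  let ?M = "sup_norm f + 1 / (\<omega>\<^sub>0 - \<omega>) * N"
  have cont: "continuous_on ({s..} \<times> UNIV) (\<lambda>(t, x). z t x)"
    by (rule continuous_on_eq[OF mild_solution_continuous_on]) (auto simp: z)
  have bound: "\<bar>z t x\<bar> \<le> exp (- \<omega> * (t - s)) * ?M" if "s \<le> t" for t x
    using mild_solution_decay[OF that] z[OF that] by simp
  have norm: "exp (\<omega> * (t - s)) * sup_norm (z t) \<le> ?M" if "s \<le> t" for t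
  proof -
    have "exp (\<omega> * (t - s)) * sup_norm (z t) \<le> exp (\<omega> * (t - s)) * (exp (- \<omega> * (t - s)) * ?M)"
      by (intro mult_left_mono sup_norm_le bound that) simp
    also have "\<dots> = ?M" by (simp add: mult.assoc[symmetric] flip: exp_add)
    finally show ?thesis .
  qed
  have "z t \<in> bcontfun" if "s \<le> t" for t
    using continuous_on_Times_slice[OF cont, of t] that bound[OF that]
    by (auto simp: bcontfun_def bounded_iff)
  with cont norm show "z \<in> C_omega \<omega> s"
    by (auto simp: C_omega_iff intro!: bdd_aboveI)
  show "C_omega_norm \<omega> s z \<le> ?M"
    unfolding C_omega_norm_def[of _ _ z] using norm by (intro cSUP_least) auto
qed

end

theorem proposition5p4:
  fixes J :: "real set"
    and Q :: "real \<Rightarrow> real^'d \<Rightarrow> real^'d^'d"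
    and b :: "real \<Rightarrow> real^'d \<Rightarrow> real^'d"
    and G :: "real \<Rightarrow> real \<Rightarrow> (real^'d \<Rightarrow> real) \<Rightarrow> real^'d \<Rightarrow> real"
    and \<psi> :: "real \<Rightarrow> real \<Rightarrow> real"
    and f :: "real^'d \<Rightarrow> real"
    and g :: "real \<Rightarrow> real^'d \<Rightarrow> real"
    and z :: "real \<Rightarrow> real^'d \<Rightarrow> real"
    and \<alpha> \<omega>\<^sub>0 \<omega> s :: real
  assumes "J = UNIV \<or> (\<exists>T. J = {T<..})"
    and "standing_assumptions \<alpha> J Q b"
    and "evolution_operator J Q b G"
    and "\<forall>t\<in>J. \<psi> t 0 = 0"
    and "\<forall>t\<in>J. cont_differentiable_at (\<psi> t) 0"
    and "holder_loc (\<alpha> / 2) J (\<lambda>t. deriv (\<psi> t) 0)"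
    and "bdd_above ((\<lambda>t. deriv (\<psi> t) 0) ` J)"
    and "(SUP t\<in>J. deriv (\<psi> t) 0) = - \<omega>\<^sub>0"
    and "- \<omega>\<^sub>0 < 0"
    and "\<omega> \<in> {0..<\<omega>\<^sub>0}"
    and "s \<in> J"
    and "f \<in> bcontfun"
    and "g \<in> C_omega \<omega> s"
    and "\<forall>t\<ge>s. \<forall>x. z t x = mild_solution \<psi> G s f g t x"
  shows "z \<in> C_omega \<omega> s \<and>
    C_omega_norm \<omega> s z \<le> sup_norm f + 1 / (\<omega>\<^sub>0 - \<omega>) * C_omega_norm \<omega> s g"
proof -
  have \<alpha>: "\<alpha> > 0" using assms(2) by (simp add: standing_assumptions_def)
  have openJ: "open J" and upJ: "\<And>r. r \<in> J \<Longrightarrow> {r..} \<subseteq> J" using assms(1) by auto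
  obtain \<eta> :: "real \<Rightarrow> real^'d \<Rightarrow> real" where
    \<eta>: "\<And>t x \<xi>. t \<in> J \<Longrightarrow> (Q t x *v \<xi>) \<bullet> \<xi> \<ge> \<eta> t x * (norm \<xi>)\<^sup>2"
      "bdd_below ((\<lambda>(t, x). \<eta> t x) ` (J \<times> UNIV))" "(INF (t, x)\<in>J \<times> UNIV. \<eta> t x) > 0"
    using assms(2) unfolding standing_assumptions_def by blast
  obtain \<phi> a c where \<phi>: "C2 \<phi>" "\<And>x. \<phi> x \<ge> 0" "a > 0" "c > 0" "filterlim \<phi> at_top at_infinity"
      "\<And>t x. t \<in> J \<Longrightarrow> elliptic_op Q b t \<phi> x \<le> a - c * \<phi> x"
    using assms(2) unfolding standing_assumptions_def by blast
  have "mild_problem J Q b \<phi> a G \<psi> \<omega>\<^sub>0 s \<omega> f g"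
  proof unfold_locales
    show "transpose (Q t x) = Q t x" if "t \<in> J" for t x
      using assms(2) that by (simp add: standing_assumptions_def)
    show "(Q t x *v \<xi>) \<bullet> \<xi> > 0" if "t \<in> J" "\<xi> \<noteq> 0" for t x \<xi>
    proof -
      \<comment> \<open>Uniform ellipticity enters as strict positive definiteness at each
        point.\<close>
      have "(INF (t, x)\<in>J \<times> UNIV. \<eta> t x) \<le> (case (t, x) of (t, x) \<Rightarrow> \<eta> t x)"
        using \<eta>(2) that by (intro cINF_lower) auto
      then have "\<eta> t x * (norm \<xi>)\<^sup>2 > 0" using \<eta>(3) that by simp
      then show ?thesis using \<eta>(1)[OF that(1), of x \<xi>] by linarith
    qed
    \<comment> \<open>The dissipative term \<open>c * \<phi> x\<close> is nonnegative, so the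
      Lyapunov inequality gives the constant bound \<open>a\<close>.\<close>
    show "elliptic_op Q b t \<phi> x \<le> a" if "t \<in> J" for t x
      using \<phi>(6)[OF that, of x] mult_nonneg_nonneg[OF less_imp_le[OF \<phi>(4)] \<phi>(2)[of x]] by linarith
    show "continuous_on J (\<lambda>t. deriv (\<psi> t) 0)"
      by (rule holder_loc_continuous_on[OF assms(6) openJ]) (use \<alpha> in simp)
    show "deriv (\<psi> t) 0 \<le> - \<omega>\<^sub>0" if "t \<in> J" for t
      using cSUP_upper[OF that assms(7)] assms(8) by simp
  qed (use assms \<phi> upJ in auto)
  then interpret mild_problem J Q b \<phi> a G \<psi> \<omega>\<^sub>0 s \<omega> f g .
  show ?thesis using C_omega_mild_solution assms(14) by blast
qed

end
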